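(* Let $(X,b)$ be a connected weighted graph and $\Omega$ a subset of $X$ satisfying a global topological Poincaré inequality, i.e. there exists $c>0$ with $\|f\|_\infty^2\le c\,\mathcal E(f)$ for all $f\in\mathcal D$ with $\mathrm{supp}(f)\subset\Omega$. Let $c_P^\Omega$ be the best (smallest) constant $c$ in this inequality. Then $H_m^\Omega$ has pure point spectrum for any probability measure $m$ of full support in $\Omega$. Moreover, $$\frac1{c_P^\Omega}=\inf_m\{\lambda_0\mid\lambda_0\text{ lowest eigenvalue of }H_m^\Omega\},$$ where the infimum is taken over all probability measures $m$ on $\Omega$ of full support.
   Context: A weighted graph $(X,b)$ consists of a nonempty countable (finite or infinite) set $X$ and a symmetric function $b:X\times X\to[0,\infty)$ with $b(x,x)=0$ for all $x\in X$ (no summability or local finiteness is assumed). It is connected if for any $x,y\in X$ there are $x=x_0,x_1,\dots,x_k=y$ with $b(x_j,x_{j+1})>0$ for $0\le j<k$. Let $\mathcal D=\{f:X\to\mathbb R\mid \sum_{x,y\in X}b(x,y)|f(x)-f(y)|^2<\infty\}$ and $\mathcal E(f,g)=\frac12\sum_{x,y\in X}b(x,y)(f(x)-f(y))(g(x)-g(y))$, $\mathcal E(f)=\mathcal E(f,f)$. $\mathrm{supp}(f)=\{x\mid f(x)\ne0\}$, $\|f\|_\infty=\sup_{x\in X}|f(x)|$. For a measure $m$ of full support on $\Omega$ (i.e. $m(\{x\})>0$ for all $x\in\Omega$), $\mathcal E^\Omega$ is the restriction of $\mathcal E$ to the functions $f\in\mathcal D$ vanishing outside $\Omega$ with $\sum_{x\in\Omega}|f(x)|^2m(\{x\})<\infty$.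 It is a closed form on $\ell^2(\Omega,m)$, not necessarily densely defined; $H^\Omega_m$ is the associated nonnegative selfadjoint operator in the closure of the form domain in $\ell^2(\Omega,m)$. Pure point spectrum means that this Hilbert space has an orthonormal basis of eigenvectors; in the situation of the claim the eigenvalues can be listed in increasing order. Conventions in degenerate cases: if the form domain is $\{0\}$ the lowest eigenvalue is $+\infty$; $1/0=+\infty$, $\inf\emptyset=+\infty$. *)

theory Defs
  imports "HOL-Probability.Probability_Mass_Function"
begin

text \<open>
  The countable vertex set \<open>X\<close> is the universe of a type of class \<^class>\<open>countable\<close>.
\<close>

definition weighted_graph :: "('v::countable \<Rightarrow> 'v \<Rightarrow> real) \<Rightarrow> bool" where
  "weighted_graph b \<longleftrightarrow>
     (\<forall>x y. 0 \<le> b x y) \<and> (\<forall>x y. b x y = b y x) \<and> (\<forall>x. b x x = 0)"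

definition connected_graph :: "('v::countable \<Rightarrow> 'v \<Rightarrow> real) \<Rightarrow> bool" where
  "connected_graph b \<longleftrightarrow> (\<forall>x y. (\<lambda>u v. b u v > 0)\<^sup>*\<^sup>* x y)"

definition finite_energy :: "('v::countable \<Rightarrow> 'v \<Rightarrow> real) \<Rightarrow> ('v \<Rightarrow> real) set" where
  "finite_energy b = {f. (\<lambda>(x, y). b x y * \<bar>f x - f y\<bar>\<^sup>2) summable_on UNIV}"

definition energy :: "('v::countable \<Rightarrow> 'v \<Rightarrow> real) \<Rightarrow> ('v \<Rightarrow> real) \<Rightarrow> ('v \<Rightarrow> real) \<Rightarrow> real" where
  "energy b f g = 1/2 * (\<Sum>\<^sub>\<infinity>(x, y)\<in>UNIV. b x y * (f x - f y) * (g x - g y))"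

definition supp :: "('v \<Rightarrow> real) \<Rightarrow> 'v set" where
  "supp f = {x. f x \<noteq> 0}"

text \<open>Extended-real valued, so that an unbounded function has sup norm \<open>\<infinity>\<close>.\<close>

definition sup_norm :: "('v \<Rightarrow> real) \<Rightarrow> ereal" where
  "sup_norm f = (SUP x. ereal \<bar>f x\<bar>)"

definition poincare_const :: "('v::countable \<Rightarrow> 'v \<Rightarrow> real) \<Rightarrow> 'v set \<Rightarrow> real \<Rightarrow> bool" where
  "poincare_const b \<Omega> c \<longleftrightarrow>
     (\<forall>f\<in>finite_energy b. supp f \<subseteq> \<Omega> \<longrightarrow> (sup_norm f)\<^sup>2 \<le> ereal (c * energy b f f))"

definition global_poincare :: "('v::countable \<Rightarrow> 'v \<Rightarrow> real) \<Rightarrow> 'v set \<Rightarrow> bool" where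
  "global_poincare b \<Omega> \<longleftrightarrow> (\<exists>c>0. poincare_const b \<Omega> c)"

text \<open>
  The constraint \<open>0 \<le> c\<close> only matters if \<open>0\<close> is the sole function of finite energy supported
  in \<open>\<Omega>\<close>; the best constant is then \<open>0\<close>.
\<close>

definition best_poincare_const :: "('v::countable \<Rightarrow> 'v \<Rightarrow> real) \<Rightarrow> 'v set \<Rightarrow> real" where
  "best_poincare_const b \<Omega> = Inf {c. 0 \<le> c \<and> poincare_const b \<Omega> c}"

text \<open>
  A measure of full support on \<open>\<Omega>\<close> is given by its point weights \<open>w x = m {x}\<close>, positive
  on \<open>\<Omega>\<close>. Elements of \<open>\<ell>\<^sup>2(\<Omega>, m)\<close> are represented by their extension by zero to \<open>X\<close>.
\<close>

definition l2 :: "'v set \<Rightarrow> ('v \<Rightarrow> real) \<Rightarrow> ('v \<Rightarrow> real) set" where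
  "l2 \<Omega> w = {f. supp f \<subseteq> \<Omega> \<and> (\<lambda>x. \<bar>f x\<bar>\<^sup>2 * w x) summable_on \<Omega>}"

definition l2_inner :: "'v set \<Rightarrow> ('v \<Rightarrow> real) \<Rightarrow> ('v \<Rightarrow> real) \<Rightarrow> ('v \<Rightarrow> real) \<Rightarrow> real" where
  "l2_inner \<Omega> w f g = (\<Sum>\<^sub>\<infinity>x\<in>\<Omega>. f x * g x * w x)"

definition l2_norm :: "'v set \<Rightarrow> ('v \<Rightarrow> real) \<Rightarrow> ('v \<Rightarrow> real) \<Rightarrow> real" where
  "l2_norm \<Omega> w f = sqrt (l2_inner \<Omega> w f f)"

definition l2_closure :: "'v set \<Rightarrow> ('v \<Rightarrow> real) \<Rightarrow> ('v \<Rightarrow> real) set \<Rightarrow> ('v \<Rightarrow> real) set" where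
  "l2_closure \<Omega> w S =
     {f \<in> l2 \<Omega> w. \<exists>F. (\<forall>n. F n \<in> S) \<and> (\<lambda>n. l2_norm \<Omega> w (\<lambda>x. F n x - f x)) \<longlonglongrightarrow> 0}"

definition form_dom ::
    "('v::countable \<Rightarrow> 'v \<Rightarrow> real) \<Rightarrow> 'v set \<Rightarrow> ('v \<Rightarrow> real) \<Rightarrow> ('v \<Rightarrow> real) set" where
  "form_dom b \<Omega> w = finite_energy b \<inter> l2 \<Omega> w"

definition form_space ::
    "('v::countable \<Rightarrow> 'v \<Rightarrow> real) \<Rightarrow> 'v set \<Rightarrow> ('v \<Rightarrow> real) \<Rightarrow> ('v \<Rightarrow> real) set" where
  "form_space b \<Omega> w = l2_closure \<Omega> w (form_dom b \<Omega> w)"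

text \<open>
  The graph of the operator \<open>H\<close> associated with the form \<^const>\<open>energy\<close> on \<^const>\<open>form_dom\<close>, acting in
  the Hilbert space \<^const>\<open>form_space\<close>: \<open>H f = g\<close> iff \<open>\<E>(f, h) = \<langle>g, h\<rangle>\<close> for all \<open>h\<close> in the form
  domain.
\<close>

definition form_operator ::
    "('v::countable \<Rightarrow> 'v \<Rightarrow> real) \<Rightarrow> 'v set \<Rightarrow> ('v \<Rightarrow> real) \<Rightarrow> (('v \<Rightarrow> real) \<times> ('v \<Rightarrow> real)) set" where
  "form_operator b \<Omega> w =
     {(f, g). f \<in> form_dom b \<Omega> w \<and> g \<in> form_space b \<Omega> w \<and>
              (\<forall>h\<in>form_dom b \<Omega> w. energy b f h = l2_inner \<Omega> w g h)}"

definition eigenvector ::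
    "('v::countable \<Rightarrow> 'v \<Rightarrow> real) \<Rightarrow> 'v set \<Rightarrow> ('v \<Rightarrow> real) \<Rightarrow> real \<Rightarrow> ('v \<Rightarrow> real) \<Rightarrow> bool" where
  "eigenvector b \<Omega> w l f \<longleftrightarrow> f \<noteq> (\<lambda>x. 0) \<and> (f, \<lambda>x. l * f x) \<in> form_operator b \<Omega> w"

definition eigenvalue ::
    "('v::countable \<Rightarrow> 'v \<Rightarrow> real) \<Rightarrow> 'v set \<Rightarrow> ('v \<Rightarrow> real) \<Rightarrow> real \<Rightarrow> bool" where
  "eigenvalue b \<Omega> w l \<longleftrightarrow> (\<exists>f. eigenvector b \<Omega> w l f)"

definition lin_span :: "('v \<Rightarrow> real) set \<Rightarrow> ('v \<Rightarrow> real) set" where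
  "lin_span B = {(\<lambda>x. \<Sum>e\<in>F. a e * e x) | F a. finite F \<and> F \<subseteq> B}"

definition orthonormal_basis ::
    "'v set \<Rightarrow> ('v \<Rightarrow> real) \<Rightarrow> ('v \<Rightarrow> real) set \<Rightarrow> ('v \<Rightarrow> real) set \<Rightarrow> bool" where
  "orthonormal_basis \<Omega> w H B \<longleftrightarrow>
     B \<subseteq> H \<and>
     (\<forall>e\<in>B. \<forall>e'\<in>B. l2_inner \<Omega> w e e' = (if e = e' then 1 else 0)) \<and>
     l2_closure \<Omega> w (lin_span B) = H"

definition pure_point_spectrum ::
    "('v::countable \<Rightarrow> 'v \<Rightarrow> real) \<Rightarrow> 'v set \<Rightarrow> ('v \<Rightarrow> real) \<Rightarrow> bool" where
  "pure_point_spectrum b \<Omega> w \<longleftrightarrow>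
     (\<exists>B. orthonormal_basis \<Omega> w (form_space b \<Omega> w) B \<and>
          (\<forall>e\<in>B. \<exists>l. eigenvector b \<Omega> w l e))"

text \<open>By convention the lowest eigenvalue is \<open>\<infinity>\<close> if the form domain is trivial.\<close>

definition lowest_eigenvalue ::
    "('v::countable \<Rightarrow> 'v \<Rightarrow> real) \<Rightarrow> 'v set \<Rightarrow> ('v \<Rightarrow> real) \<Rightarrow> ereal \<Rightarrow> bool" where
  "lowest_eigenvalue b \<Omega> w l0 \<longleftrightarrow>
     (if form_dom b \<Omega> w = {\<lambda>x. 0} then l0 = \<infinity>
      else \<exists>l. l0 = ereal l \<and> eigenvalue b \<Omega> w l \<and> (\<forall>l'. eigenvalue b \<Omega> w l' \<longrightarrow> l \<le> l'))"

end

theory Submission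
  imports Defs "HOL-Complex_Analysis.Great_Picard" "HOL-Probability.Product_PMF"
begin

text \<open>
  By the Poincare inequality a set of functions of bounded energy is uniformly bounded, so every
  sequence in it has a pointwise convergent subsequence. Energy is lower semicontinuous under
  pointwise limits (Fatou), and since \<open>m\<close> is a probability measure, dominated convergence gives
  convergence in \<open>\<ell>\<^sup>2\<close>, so the form domain embeds compactly. Hence the Rayleigh quotient attains
  its minimum on the orthogonal complement of any set of eigenvectors, and the minimizer is again an
  eigenvector; a maximal orthonormal set of eigenvectors is therefore a basis.

  If \<open>f\<close> is an eigenvector for \<open>\<lambda>\<close>, then \<open>\<parallel>f\<parallel>\<^sup>2 \<le> \<parallel>f\<parallel>\<^sub>\<infinity>\<^sup>2 \<le> c \<E>(f) = c \<lambda> \<parallel>f\<parallel>\<^sup>2\<close>, so \<open>\<lambda> \<ge> 1/c\<close>. The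
  bound is approached by probability measures that are concentrated near a point at which some \<open>f\<close>
  almost violates the Poincare inequality.
\<close>

subsection \<open>Weighted square-summable functions\<close>

text \<open>The index set is kept abstract because two instances are used: pairs of vertices with
  weight \<open>b\<close> for the energy, and \<open>\<Omega>\<close> with weight
  \<open>pmf m\<close> for the l2 inner product.\<close>

definition sq_summable :: "'i set \<Rightarrow> ('i \<Rightarrow> real) \<Rightarrow> ('i \<Rightarrow> real) \<Rightarrow> bool" where
  "sq_summable A W u \<longleftrightarrow> (\<lambda>i. W i * (u i)\<^sup>2) summable_on A"

definition weighted_inner :: "'i set \<Rightarrow> ('i \<Rightarrow> real) \<Rightarrow> ('i \<Rightarrow> real) \<Rightarrow> ('i \<Rightarrow> real) \<Rightarrow> real" where
  "weighted_inner A W u v = (\<Sum>\<^sub>\<infinity>i\<in>A. W i * u i * v i)"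

lemma weighted_inner_commute: "weighted_inner A W u v = weighted_inner A W v u"
  by (simp add: weighted_inner_def mult_ac)

lemma weighted_inner_self: "weighted_inner A W u u = (\<Sum>\<^sub>\<infinity>i\<in>A. W i * (u i)\<^sup>2)"
  by (simp add: weighted_inner_def power2_eq_square mult_ac)

context
  fixes A :: "'i set" and W :: "'i \<Rightarrow> real"
  assumes W: "\<And>i. i \<in> A \<Longrightarrow> 0 \<le> W i"
begin

lemma weighted_prod_summable:
  assumes "sq_summable A W u" "sq_summable A W v"
  shows "(\<lambda>i. W i * u i * v i) summable_on A"
proof (rule abs_summable_summable, rule summable_on_comparison_test)
  show "(\<lambda>i. W i * (u i)\<^sup>2 + W i * (v i)\<^sup>2) summable_on A"
    using assms unfolding sq_summable_def by (rule summable_on_add)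
next
  fix i assume i: "i \<in> A"
  have "0 \<le> (\<bar>u i\<bar> - \<bar>v i\<bar>)\<^sup>2"
    by simp
  then have "2 * (\<bar>u i\<bar> * \<bar>v i\<bar>) \<le> (u i)\<^sup>2 + (v i)\<^sup>2"
    by (simp add: power2_diff)
  moreover have "0 \<le> \<bar>u i\<bar> * \<bar>v i\<bar>"
    by simp
  ultimately have "\<bar>u i\<bar> * \<bar>v i\<bar> \<le> (u i)\<^sup>2 + (v i)\<^sup>2"
    by linarith
  then have "W i * (\<bar>u i\<bar> * \<bar>v i\<bar>) \<le> W i * ((u i)\<^sup>2 + (v i)\<^sup>2)"
    by (rule mult_left_mono) (rule W[OF i])
  then show "norm (W i * u i * v i) \<le> W i * (u i)\<^sup>2 + W i * (v i)\<^sup>2"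
    using W[OF i] by (simp add: abs_mult algebra_simps)
qed simp

lemma sq_summable_add_mult:
  assumes u: "sq_summable A W u" and v: "sq_summable A W v"
  shows "sq_summable A W (\<lambda>i. u i + t * v i)"
proof -
  have "(\<lambda>i. W i * (u i)\<^sup>2 + (2 * t) * (W i * u i * v i) + t\<^sup>2 * (W i * (v i)\<^sup>2)) summable_on A"
    using weighted_prod_summable[OF u v] u v unfolding sq_summable_def
    by (intro summable_on_add summable_on_cmult_right)
  then show ?thesis
    unfolding sq_summable_def by (rule summable_on_cong[THEN iffD1, rotated])
      (simp add: power2_eq_square algebra_simps)
qed

lemma weighted_inner_add_mult_left:
  assumes u: "sq_summable A W u" and v: "sq_summable A W v" and h: "sq_summable A W h"
  shows "weighted_inner A W (\<lambda>i. u i + t * v i) h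
    = weighted_inner A W u h + t * weighted_inner A W v h"
proof -
  have "weighted_inner A W (\<lambda>i. u i + t * v i) h
      = (\<Sum>\<^sub>\<infinity>i\<in>A. W i * u i * h i + t * (W i * v i * h i))"
    unfolding weighted_inner_def by (rule infsum_cong) (simp add: algebra_simps)
  also have "\<dots> = weighted_inner A W u h + t * weighted_inner A W v h"
    unfolding weighted_inner_def
    using weighted_prod_summable[OF u h] weighted_prod_summable[OF v h]
    by (simp add: infsum_add infsum_cmult_right' summable_on_cmult_right)
  finally show ?thesis .
qed

lemma weighted_inner_nonneg: "0 \<le> weighted_inner A W u u"
  unfolding weighted_inner_self by (intro infsum_nonneg) (simp add: W)

lemma weighted_inner_point_le:
  assumes u: "sq_summable A W u" and i: "i \<in> A"
  shows "W i * (u i)\<^sup>2 \<le> weighted_inner A W u u"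
  using finite_sum_le_infsum[of "\<lambda>i. W i * (u i)\<^sup>2" A "{i}"] u i W
  unfolding weighted_inner_self sq_summable_def by simp

text \<open>Fatou's lemma for series: each finite partial sum passes to the limit and stays below
  \<open>M\<close>, and a sum of nonnegative terms is the supremum of its finite partial
  sums.\<close>

lemma weighted_inner_fatou:
  fixes U :: "nat \<Rightarrow> 'i \<Rightarrow> real"
  assumes U: "\<And>n. sq_summable A W (U n)" and M: "\<And>n. weighted_inner A W (U n) (U n) \<le> M"
    and lim: "\<And>i. i \<in> A \<Longrightarrow> (\<lambda>n. U n i) \<longlonglongrightarrow> u i"
  shows "sq_summable A W u" and "weighted_inner A W u u \<le> M"
proof -
  have fin: "(\<Sum>i\<in>F. W i * (u i)\<^sup>2) \<le> M" if F: "finite F" "F \<subseteq> A" for F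
  proof (rule LIMSEQ_le_const2)
    show "(\<lambda>n. \<Sum>i\<in>F. W i * (U n i)\<^sup>2) \<longlonglongrightarrow> (\<Sum>i\<in>F. W i * (u i)\<^sup>2)"
      using F by (intro tendsto_intros lim) auto
    have "(\<Sum>i\<in>F. W i * (U n i)\<^sup>2) \<le> M" for n
      using finite_sum_le_infsum[of "\<lambda>i. W i * (U n i)\<^sup>2" A F] F W U[of n] M[of n]
      unfolding weighted_inner_self sq_summable_def by fastforce
    then show "\<exists>N. \<forall>n\<ge>N. (\<Sum>i\<in>F. W i * (U n i)\<^sup>2) \<le> M"
      by blast
  qed
  show u: "sq_summable A W u"
    unfolding sq_summable_def
    by (rule nonneg_bdd_above_summable_on) (auto simp: W intro!: bdd_aboveI[of _ M] fin)
  show "weighted_inner A W u u \<le> M"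
    unfolding weighted_inner_self
    using u unfolding sq_summable_def by (rule infsum_le_finite_sums) (rule fin)
qed

lemma weighted_inner_add_le:
  assumes u: "sq_summable A W u" and v: "sq_summable A W v"
  shows "weighted_inner A W (\<lambda>i. u i + v i) (\<lambda>i. u i + v i)
    \<le> 2 * weighted_inner A W u u + 2 * weighted_inner A W v v"
proof -
  have "weighted_inner A W (\<lambda>i. u i + v i) (\<lambda>i. u i + v i)
      \<le> (\<Sum>\<^sub>\<infinity>i\<in>A. 2 * (W i * (u i)\<^sup>2) + 2 * (W i * (v i)\<^sup>2))"
    unfolding weighted_inner_self
  proof (rule infsum_mono)
    show "(\<lambda>i. W i * (u i + v i)\<^sup>2) summable_on A"
      using sq_summable_add_mult[OF u v, of 1] by (simp add: sq_summable_def)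
    show "(\<lambda>i. 2 * (W i * (u i)\<^sup>2) + 2 * (W i * (v i)\<^sup>2)) summable_on A"
      using u v unfolding sq_summable_def by (intro summable_on_add summable_on_cmult_right)
    fix i assume i: "i \<in> A"
    have "0 \<le> (u i - v i)\<^sup>2"
      by simp
    then have "(u i + v i)\<^sup>2 \<le> 2 * (u i)\<^sup>2 + 2 * (v i)\<^sup>2"
      by (simp add: power2_eq_square algebra_simps)
    from mult_left_mono[OF this W[OF i]]
    show "W i * (u i + v i)\<^sup>2 \<le> 2 * (W i * (u i)\<^sup>2) + 2 * (W i * (v i)\<^sup>2)"
      by (simp add: algebra_simps)
  qed
  also have "\<dots> = 2 * weighted_inner A W u u + 2 * weighted_inner A W v v"
    using u v unfolding weighted_inner_self sq_summable_def
    by (simp add: infsum_add infsum_cmult_right' summable_on_cmult_right)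
  finally show ?thesis .
qed

end

text \<open>Near \<open>t = 0\<close> a quadratic term cannot dominate a linear one unless the
  latter vanishes. This is how minimality along a line becomes a first-order identity.\<close>

lemma linear_le_quadratic_imp_zero:
  fixes p q :: real
  assumes "\<And>t. 2 * t * p \<le> t\<^sup>2 * q"
  shows "p = 0"
proof (rule ccontr)
  assume "p \<noteq> 0"
  \<comment> \<open>The test value will be \<open>t = s * p\<close>; the absolute value makes
    \<open>s * q < 1\<close> whatever the sign of \<open>q\<close>.\<close>
  define s where "s = 1 / (\<bar>q\<bar> + 1)"
  have s: "0 < s" "s * q < 1"
    unfolding s_def by (auto simp: divide_simps abs_if)
  have "2 * (s * p) * p \<le> (s * p)\<^sup>2 * q"
    by (rule assms)
  also have "\<dots> = (s * p * p) * (s * q)"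
    by (simp add: power2_eq_square)
  also have "\<dots> < (s * p * p) * 1"
    using s \<open>p \<noteq> 0\<close> by (intro mult_strict_left_mono) (auto simp: mult.assoc zero_less_mult_iff)
  finally have "s * p * p < 0"
    by linarith
  moreover have "0 \<le> s * p * p"
    using s(1) by (simp add: mult.assoc)
  ultimately show False
    by linarith
qed

lemma LIMSEQ_inverse_Suc: "(\<lambda>n. 1 / real (Suc n)) \<longlonglongrightarrow> 0"
  using LIMSEQ_inverse_real_of_nat by (simp add: inverse_eq_divide)

section \<open>Dominated convergence for a probability measure\<close>

lemma expectation_tendsto_bounded:
  fixes m :: "'v pmf" and U :: "nat \<Rightarrow> 'v \<Rightarrow> real"
  assumes "\<And>x. (\<lambda>n. U n x) \<longlonglongrightarrow> u x" and "\<And>n x. \<bar>U n x\<bar> \<le> K"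
  shows "(\<lambda>n. measure_pmf.expectation m (U n)) \<longlonglongrightarrow> measure_pmf.expectation m u"
  by (rule integral_dominated_convergence[where w = "\<lambda>_. K"]) (use assms in auto)

text \<open>Rewriting the sum as an integral makes dominated convergence available. Boundedness of
  the product supplies absolute summability, and points outside \<open>\<Omega>\<close> have mass
  zero.\<close>

lemma l2_inner_pmf_eq_expectation:
  fixes m :: "'v pmf"
  assumes m: "set_pmf m = \<Omega>" and bd: "\<And>x. \<bar>f x * g x\<bar> \<le> K"
  shows "l2_inner \<Omega> (pmf m) f g = measure_pmf.expectation m (\<lambda>x. f x * g x)"
proof -
  have "Infinite_Set_Sum.abs_summable_on (\<lambda>x. pmf m x * (f x * g x)) UNIV"
  proof (rule Infinite_Set_Sum.abs_summable_on_comparison_test)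
    show "Infinite_Set_Sum.abs_summable_on (\<lambda>x. K * pmf m x) UNIV"
      by (intro Infinite_Set_Sum.abs_summable_on_cmult_right pmf_abs_summable)
    show "norm (pmf m x * (f x * g x)) \<le> norm (K * pmf m x)" for x
      using mult_left_mono[OF bd[of x], of "pmf m x"] order.trans[OF abs_ge_zero bd[of x]]
      by (simp add: abs_mult mult_ac)
  qed
  then have "measure_pmf.expectation m (\<lambda>x. f x * g x) = (\<Sum>\<^sub>\<infinity>x. pmf m x * (f x * g x))"
    unfolding pmf_expectation_eq_infsetsum by (rule infsetsum_infsum)
  also have "\<dots> = l2_inner \<Omega> (pmf m) f g"
    unfolding l2_inner_def using m
    by (intro infsum_cong_neutral) (auto simp: set_pmf_iff mult_ac)
  finally show ?thesis ..
qed

subsection \<open>Functions of finite energy supported in \<open>\<Omega>\<close>\<close>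

text \<open>As \<open>grad\<close> is linear, the energy becomes half of a weighted inner product
  over pairs and inherits its algebra and its Fatou property.\<close>

definition grad :: "('v \<Rightarrow> real) \<Rightarrow> 'v \<times> 'v \<Rightarrow> real" where
  "grad f = (\<lambda>(x, y). f x - f y)"

lemma grad_add_mult: "grad (\<lambda>x. f x + t * g x) = (\<lambda>p. grad f p + t * grad g p)"
  by (auto simp: grad_def fun_eq_iff algebra_simps)

lemma finite_energy_iff: "f \<in> finite_energy b \<longleftrightarrow> sq_summable UNIV (case_prod b) (grad f)"
  by (simp add: finite_energy_def sq_summable_def grad_def case_prod_unfold)

lemma energy_eq: "energy b f g = 1/2 * weighted_inner UNIV (case_prod b) (grad f) (grad g)"
  by (simp add: energy_def weighted_inner_def grad_def case_prod_unfold)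

lemma energy_self_nonneg: "weighted_graph b \<Longrightarrow> 0 \<le> energy b f f"
  by (auto simp: energy_eq weighted_graph_def intro!: weighted_inner_nonneg split: prod.split)

lemma l2_iff: "f \<in> l2 \<Omega> w \<longleftrightarrow> supp f \<subseteq> \<Omega> \<and> sq_summable \<Omega> w f"
  by (simp add: l2_def sq_summable_def mult.commute)

lemma l2_inner_eq: "l2_inner \<Omega> w f g = weighted_inner \<Omega> w f g"
  by (simp add: l2_inner_def weighted_inner_def mult_ac)

lemma supp_add_mult: "supp f \<subseteq> \<Omega> \<Longrightarrow> supp g \<subseteq> \<Omega> \<Longrightarrow> supp (\<lambda>x. f x + t * g x) \<subseteq> \<Omega>"
  by (fastforce simp: supp_def)

text \<open>These are the test functions of the Poincare inequality. No measure enters, yet under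
  that inequality \<open>form_dom_eq\<close> identifies the set with the form domain.\<close>

definition energy_functions :: "('v::countable \<Rightarrow> 'v \<Rightarrow> real) \<Rightarrow> 'v set \<Rightarrow> ('v \<Rightarrow> real) set" where
  "energy_functions b \<Omega> = {f \<in> finite_energy b. supp f \<subseteq> \<Omega>}"

lemma zero_in_energy_functions: "(\<lambda>x. 0) \<in> energy_functions b \<Omega>"
  by (simp add: energy_functions_def supp_def finite_energy_def case_prod_unfold)

lemma poincare_const_iff:
  "poincare_const b \<Omega> c \<longleftrightarrow> (\<forall>f\<in>energy_functions b \<Omega>. \<forall>x. (f x)\<^sup>2 \<le> c * energy b f f)"
    (is "?L \<longleftrightarrow> ?R")
proof
  assume L: ?L
  show ?R
  proof (intro ballI allI)
    fix f x
    assume "f \<in> energy_functions b \<Omega>"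
    with L have "(sup_norm f)\<^sup>2 \<le> ereal (c * energy b f f)"
      by (simp add: poincare_const_def energy_functions_def)
    moreover have "ereal \<bar>f x\<bar> \<le> sup_norm f"
      unfolding sup_norm_def by (rule SUP_upper) simp
    then have "ereal \<bar>f x\<bar> * ereal \<bar>f x\<bar> \<le> sup_norm f * sup_norm f"
      by (intro ereal_mult_mono) (auto intro: order_trans[rotated])
    ultimately have "ereal \<bar>f x\<bar> * ereal \<bar>f x\<bar> \<le> ereal (c * energy b f f)"
      unfolding power2_eq_square by (rule order.trans[rotated])
    then show "(f x)\<^sup>2 \<le> c * energy b f f"
      by (simp add: power2_eq_square)
  qed
next
  assume R: ?R
  show ?L
    unfolding poincare_const_def
  proof (intro ballI impI)
    fix f
    assume "f \<in> finite_energy b" "supp f \<subseteq> \<Omega>"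
    with R have le: "(f x)\<^sup>2 \<le> c * energy b f f" for x
      by (simp add: energy_functions_def)
    then have nn: "0 \<le> c * energy b f f"
      by (meson order_trans zero_le_power2)
    have "sup_norm f \<le> ereal (sqrt (c * energy b f f))"
      unfolding sup_norm_def using le by (intro SUP_least) (simp add: real_le_rsqrt)
    moreover have "0 \<le> sup_norm f"
      unfolding sup_norm_def by (rule SUP_upper2[of undefined]) auto
    ultimately have "sup_norm f * sup_norm f
        \<le> ereal (sqrt (c * energy b f f)) * ereal (sqrt (c * energy b f f))"
      by (intro ereal_mult_mono) (use nn in auto)
    then show "(sup_norm f)\<^sup>2 \<le> ereal (c * energy b f f)"
      using nn by (simp add: power2_eq_square)
  qed
qed

text \<open>The constant \<open>c\<close> is any valid positive one, so that results can be
  instantiated both with the constant from the hypothesis and with the best one.\<close>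

locale poincare_form =
  fixes b :: "'v::countable \<Rightarrow> 'v \<Rightarrow> real" and \<Omega> :: "'v set" and c :: real and m :: "'v pmf"
  assumes graph: "weighted_graph b"
    and c_pos: "0 < c"
    and poincare: "poincare_const b \<Omega> c"
    and full_support: "set_pmf m = \<Omega>"
begin

abbreviation "\<D> \<equiv> energy_functions b \<Omega>"
abbreviation "\<E> \<equiv> energy b"
abbreviation "\<I> \<equiv> l2_inner \<Omega> (pmf m)"

lemma weight_nonneg: "0 \<le> case_prod b p"
  using graph by (auto simp: weighted_graph_def split: prod.split)

lemma add_mult_in_D: "f \<in> \<D> \<Longrightarrow> g \<in> \<D> \<Longrightarrow> (\<lambda>x. f x + t * g x) \<in> \<D>"
  by (simp add: energy_functions_def finite_energy_iff supp_add_mult grad_add_mult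
      sq_summable_add_mult weight_nonneg)

lemma energy_commute: "\<E> f g = \<E> g f"
  by (simp add: energy_eq weighted_inner_commute)

lemma energy_add_mult_left:
  "f \<in> \<D> \<Longrightarrow> g \<in> \<D> \<Longrightarrow> h \<in> \<D> \<Longrightarrow> \<E> (\<lambda>x. f x + t * g x) h = \<E> f h + t * \<E> g h"
  by (simp add: energy_functions_def finite_energy_iff energy_eq grad_add_mult
      weighted_inner_add_mult_left weight_nonneg algebra_simps)

lemma energy_add_mult_self:
  assumes "f \<in> \<D>" "g \<in> \<D>"
  shows "\<E> (\<lambda>x. f x + t * g x) (\<lambda>x. f x + t * g x) = \<E> f f + 2 * t * \<E> f g + t\<^sup>2 * \<E> g g"
proof -
  let ?h = "\<lambda>x. f x + t * g x"
  have "\<E> ?h ?h = \<E> f ?h + t * \<E> g ?h"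
    by (intro energy_add_mult_left add_mult_in_D assms)
  also have "\<E> f ?h = \<E> f f + t * \<E> g f"
    using energy_add_mult_left[of f g f t] assms by (simp add: energy_commute)
  also have "\<E> g ?h = \<E> f g + t * \<E> g g"
    using energy_add_mult_left[of f g g t] assms by (simp add: energy_commute)
  finally show ?thesis
    by (simp add: energy_commute[of g f] power2_eq_square algebra_simps)
qed

lemma energy_nonneg: "0 \<le> \<E> f f"
  by (rule energy_self_nonneg[OF graph])

lemma point_le_energy: "f \<in> \<D> \<Longrightarrow> (f x)\<^sup>2 \<le> c * \<E> f f"
  using poincare by (simp add: poincare_const_iff)

lemma energy_pos: "f \<in> \<D> \<Longrightarrow> f \<noteq> (\<lambda>x. 0) \<Longrightarrow> 0 < \<E> f f"
  using energy_nonneg[of f] point_le_energy[of f] by (cases "\<E> f f = 0") (auto simp: fun_eq_iff)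

lemma pmf_summable: "pmf m summable_on A"
  by (rule nonneg_bdd_above_summable_on)
    (auto intro!: bdd_aboveI[of _ 1] simp flip: measure_measure_pmf_finite)

text \<open>The Poincare inequality makes these functions bounded, and the total mass is finite, so
  square-summability is automatic.\<close>

lemma D_subset_l2: "\<D> \<subseteq> l2 \<Omega> (pmf m)"
proof
  fix f assume f: "f \<in> \<D>"
  have "sq_summable \<Omega> (pmf m) f"
    unfolding sq_summable_def
  proof (rule summable_on_comparison_test)
    show "(\<lambda>x. pmf m x * (c * \<E> f f)) summable_on \<Omega>"
      by (intro summable_on_cmult_left pmf_summable)
    show "pmf m x * (f x)\<^sup>2 \<le> pmf m x * (c * \<E> f f)" for x
      by (intro mult_left_mono point_le_energy f) simp
  qed simp
  with f show "f \<in> l2 \<Omega> (pmf m)"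
    by (simp add: l2_iff energy_functions_def)
qed

lemma form_dom_eq: "form_dom b \<Omega> (pmf m) = \<D>"
  using D_subset_l2 by (auto simp: form_dom_def energy_functions_def l2_iff)

lemma inner_commute: "\<I> f g = \<I> g f"
  by (simp add: l2_inner_eq weighted_inner_commute)

lemma add_mult_in_l2:
  "f \<in> l2 \<Omega> (pmf m) \<Longrightarrow> g \<in> l2 \<Omega> (pmf m) \<Longrightarrow> (\<lambda>x. f x + t * g x) \<in> l2 \<Omega> (pmf m)"
  by (simp add: l2_iff supp_add_mult sq_summable_add_mult)

lemma inner_add_mult_left:
  "f \<in> l2 \<Omega> (pmf m) \<Longrightarrow> g \<in> l2 \<Omega> (pmf m) \<Longrightarrow> h \<in> l2 \<Omega> (pmf m) \<Longrightarrow>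
    \<I> (\<lambda>x. f x + t * g x) h = \<I> f h + t * \<I> g h"
  by (simp add: l2_iff l2_inner_eq weighted_inner_add_mult_left)

lemma inner_mult_self: "\<I> (\<lambda>x. t * f x) (\<lambda>x. t * f x) = t\<^sup>2 * \<I> f f"
  by (simp add: l2_inner_def power2_eq_square infsum_cmult_right'[symmetric] mult_ac)

lemma inner_mult_left: "\<I> (\<lambda>x. t * f x) g = t * \<I> f g"
  by (simp add: l2_inner_def infsum_cmult_right'[symmetric] mult_ac)

lemma inner_add_mult_self:
  assumes "f \<in> l2 \<Omega> (pmf m)" "g \<in> l2 \<Omega> (pmf m)"
  shows "\<I> (\<lambda>x. f x + t * g x) (\<lambda>x. f x + t * g x) = \<I> f f + 2 * t * \<I> f g + t\<^sup>2 * \<I> g g"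
proof -
  let ?h = "\<lambda>x. f x + t * g x"
  have "\<I> ?h ?h = \<I> f ?h + t * \<I> g ?h"
    by (intro inner_add_mult_left add_mult_in_l2 assms)
  also have "\<I> f ?h = \<I> f f + t * \<I> g f"
    using inner_add_mult_left[of f g f t] assms by (simp add: inner_commute)
  also have "\<I> g ?h = \<I> f g + t * \<I> g g"
    using inner_add_mult_left[of f g g t] assms by (simp add: inner_commute)
  finally show ?thesis
    by (simp add: inner_commute[of g f] power2_eq_square algebra_simps)
qed

lemma inner_nonneg: "0 \<le> \<I> f f"
  by (simp add: l2_inner_eq weighted_inner_nonneg)

lemma inner_pos:
  assumes "f \<in> l2 \<Omega> (pmf m)" "f \<noteq> (\<lambda>x. 0)"
  shows "0 < \<I> f f"
proof -
  obtain x where x: "f x \<noteq> 0" "x \<in> \<Omega>"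
    using assms by (auto simp: l2_iff supp_def fun_eq_iff)
  then have "0 < pmf m x * (f x)\<^sup>2"
    using full_support by (auto simp: pmf_positive_iff)
  also have "\<dots> \<le> \<I> f f"
    unfolding l2_inner_eq using assms(1) x by (intro weighted_inner_point_le) (auto simp: l2_iff)
  finally show ?thesis .
qed

text \<open>The total mass is one, so the constant survives unchanged. Applied to the Poincare bound
  this yields the lower bound on the eigenvalues.\<close>

lemma inner_le_point_bound:
  assumes "\<And>x. (f x)\<^sup>2 \<le> K"
  shows "\<I> f f \<le> K"
proof -
  have "0 \<le> K"
    using assms[of undefined] by (rule order.trans[OF zero_le_power2])
  have "\<I> f f = measure_pmf.expectation m (\<lambda>x. f x * f x)"
    by (rule l2_inner_pmf_eq_expectation[OF full_support, of _ _ K])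
      (use assms in \<open>simp flip: power2_eq_square\<close>)
  also have "\<dots> \<le> measure_pmf.expectation m (\<lambda>x. K)"
    using assms \<open>0 \<le> K\<close>
    by (intro integral_mono measure_pmf.integrable_const_bound[where B = K])
      (auto simp flip: power2_eq_square)
  finally show ?thesis
    by simp
qed

section \<open>Closedness and compactness of sets of bounded energy\<close>

lemma limit_in_D:
  assumes F: "\<And>n. F n \<in> \<D>" and M: "\<And>n. \<E> (F n) (F n) \<le> M"
    and lim: "\<And>x. (\<lambda>n. F n x) \<longlonglongrightarrow> g x"
  shows "g \<in> \<D>" and "\<E> g g \<le> M"
proof -
  have F': "sq_summable UNIV (case_prod b) (grad (F n))" for n
    using F[of n] by (simp add: energy_functions_def finite_energy_iff)
  have M': "weighted_inner UNIV (case_prod b) (grad (F n)) (grad (F n)) \<le> 2 * M" for n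
    using M[of n] by (simp add: energy_eq)
  have lim': "(\<lambda>n. grad (F n) p) \<longlonglongrightarrow> grad g p" for p
    unfolding grad_def by (cases p) (auto intro: tendsto_diff lim)
  \<comment> \<open>One application gives both finite energy of the limit and the bound on it;
    \<open>2 * M\<close> absorbs the factor one half in \<open>energy\<close>.\<close>
  note fatou = weighted_inner_fatou[where U = "\<lambda>n. grad (F n)", OF weight_nonneg F' M' lim']
  have "g x = 0" if "x \<notin> \<Omega>" for x
  proof -
    have "F n x = 0" for n
      using F[of n] that by (auto simp: energy_functions_def supp_def)
    then show ?thesis
      using lim[of x] LIMSEQ_unique[OF _ tendsto_const] by simp
  qed
  then show "g \<in> \<D>"
    using fatou(1) by (auto simp: energy_functions_def finite_energy_iff supp_def)
  show "\<E> g g \<le> M"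
    using fatou(2) by (simp add: energy_eq)
qed

text \<open>The Poincare inequality bounds all functions by \<open>sqrt (c * M)\<close>; as there
  are countably many vertices, a diagonal argument yields a subsequence that converges at every
  vertex.\<close>

lemma compactness:
  fixes F :: "nat \<Rightarrow> 'v \<Rightarrow> real"
  assumes F: "\<And>n. F n \<in> \<D>" and M: "\<And>n. \<E> (F n) (F n) \<le> M"
  shows "\<exists>r g. strict_mono r \<and> (\<forall>x. (\<lambda>n. F (r n) x) \<longlonglongrightarrow> g x)"
proof -
  have bd: "norm (F n x) \<le> sqrt (c * M)" for n x
  proof -
    have "(F n x)\<^sup>2 \<le> c * M"
      using order.trans[OF point_le_energy[OF F] mult_left_mono[OF M]] c_pos by simp
    then show ?thesis
      by (simp add: real_le_rsqrt)
  qed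
  obtain r :: "nat \<Rightarrow> nat" where r: "strict_mono r" "\<And>x. \<exists>l. (\<lambda>n. F (r n) x) \<longlonglongrightarrow> l"
    using function_convergent_subsequence[OF countableI_type[of UNIV], of F "sqrt (c * M)", OF bd]
    by auto
  then obtain g where "\<And>x. (\<lambda>n. F (r n) x) \<longlonglongrightarrow> g x"
    by metis
  with r(1) show ?thesis
    by (intro exI[of _ r] exI[of _ g]) simp
qed

text \<open>Both sequences are uniformly bounded, so dominated convergence applies to the products.
  Together with \<open>compactness\<close> this is the compact embedding of the form domain.\<close>

lemma inner_tendsto:
  assumes F: "\<And>n. F n \<in> \<D>" and FM: "\<And>n. \<E> (F n) (F n) \<le> M"
    and F_lim: "\<And>x. (\<lambda>n. F n x) \<longlonglongrightarrow> f x"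
    and G: "\<And>n. G n \<in> \<D>" and GM: "\<And>n. \<E> (G n) (G n) \<le> M"
    and G_lim: "\<And>x. (\<lambda>n. G n x) \<longlonglongrightarrow> g x"
  shows "(\<lambda>n. \<I> (F n) (G n)) \<longlonglongrightarrow> \<I> f g"
proof -
  have bd: "\<bar>u x * v x\<bar> \<le> c * M"
    if "u \<in> \<D>" "v \<in> \<D>" "\<E> u u \<le> M" "\<E> v v \<le> M" for u v x
  proof -
    have "(u x)\<^sup>2 \<le> c * M" "(v x)\<^sup>2 \<le> c * M"
      using that order.trans[OF point_le_energy mult_left_mono] c_pos by fastforce+
    moreover have "0 \<le> (\<bar>u x\<bar> - \<bar>v x\<bar>)\<^sup>2"
      by simp
    ultimately show ?thesis
      by (simp add: power2_diff abs_mult)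
  qed
  note f = limit_in_D[OF F FM F_lim] and g = limit_in_D[OF G GM G_lim]
  have "\<I> (F n) (G n) = measure_pmf.expectation m (\<lambda>x. F n x * G n x)" for n
    by (rule l2_inner_pmf_eq_expectation[OF full_support bd]) (intro F G FM GM)+
  moreover have "\<I> f g = measure_pmf.expectation m (\<lambda>x. f x * g x)"
    by (rule l2_inner_pmf_eq_expectation[OF full_support bd]) (intro f g)+
  moreover have "(\<lambda>n. measure_pmf.expectation m (\<lambda>x. F n x * G n x))
      \<longlonglongrightarrow> measure_pmf.expectation m (\<lambda>x. f x * g x)"
    by (rule expectation_tendsto_bounded[where K = "c * M"])
      (auto intro!: tendsto_mult F_lim G_lim bd F G FM GM)
  ultimately show ?thesis
    by simp
qed

end

section \<open>Linear spans\<close>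

lemma lin_span_induct [consumes 1, case_names zero add]:
  assumes s: "s \<in> lin_span B" and zero: "P (\<lambda>x. 0)"
    and add: "\<And>s e t. s \<in> lin_span B \<Longrightarrow> P s \<Longrightarrow> e \<in> B \<Longrightarrow> P (\<lambda>x. s x + t * e x)"
  shows "P s"
proof -
  obtain F a where F: "finite F" "F \<subseteq> B" and s_eq: "s = (\<lambda>x. \<Sum>e\<in>F. a e * e x)"
    using s by (auto simp: lin_span_def)
  from F have "P (\<lambda>x. \<Sum>e\<in>F. a e * e x)"
  proof (induction F rule: finite_induct)
    case empty
    then show ?case
      by (simp add: zero)
  next
    case (insert e F)
    then have "P (\<lambda>x. (\<Sum>e\<in>F. a e * e x) + a e * e x)"
      by (intro add) (auto simp: lin_span_def)
    with insert show ?case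
      by (simp add: add.commute)
  qed
  then show ?thesis
    by (simp add: s_eq)
qed

lemma zero_in_lin_span: "(\<lambda>x. 0) \<in> lin_span B"
  unfolding lin_span_def by (auto intro!: exI[of _ "{}"])

lemma add_mult_in_lin_span:
  assumes "s \<in> lin_span B" "e \<in> B"
  shows "(\<lambda>x. s x + t * e x) \<in> lin_span B"
proof -
  obtain F a where F: "finite F" "F \<subseteq> B" and s_eq: "s = (\<lambda>x. \<Sum>e\<in>F. a e * e x)"
    using assms by (auto simp: lin_span_def)
  \<comment> \<open>The vector \<open>e\<close> may already occur in \<open>F\<close>; its old
    coefficient and \<open>t\<close> are then added.\<close>
  define a' where "a' = (\<lambda>d. (if d \<in> F then a d else 0) + (if d = e then t else 0))"
  have "(\<Sum>d\<in>insert e F. a' d * d x) = s x + t * e x" for x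
  proof -
    have "(\<Sum>d\<in>insert e F. a' d * d x)
        = (\<Sum>d\<in>insert e F. (if d \<in> F then a d * d x else 0))
          + (\<Sum>d\<in>insert e F. (if d = e then t * d x else 0))"
      unfolding sum.distrib[symmetric] by (rule sum.cong) (auto simp: a'_def algebra_simps)
    also have "(\<Sum>d\<in>insert e F. (if d \<in> F then a d * d x else 0)) = s x"
      unfolding s_eq using F by (intro sum.mono_neutral_cong_right) auto
    also have "(\<Sum>d\<in>insert e F. (if d = e then t * d x else 0)) = t * e x"
      using F by simp
    finally show ?thesis .
  qed
  then show ?thesis
    unfolding lin_span_def using F assms(2)
    by (intro CollectI exI[of _ "insert e F"] exI[of _ a']) auto
qed

context poincare_form
begin

lemma zero_in_D: "(\<lambda>x. 0) \<in> \<D>"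
  by (rule zero_in_energy_functions)

lemma mult_in_D: "f \<in> \<D> \<Longrightarrow> (\<lambda>x. t * f x) \<in> \<D>"
  using add_mult_in_D[OF zero_in_D, of f t] by simp

lemma in_l2: "f \<in> \<D> \<Longrightarrow> f \<in> l2 \<Omega> (pmf m)"
  using D_subset_l2 by blast

lemma energy_zero: "\<E> (\<lambda>x. 0) f = 0"
  by (simp add: energy_def case_prod_unfold)

lemma inner_zero: "\<I> (\<lambda>x. 0) f = 0"
  by (simp add: l2_inner_def)

lemma energy_mult_self: "f \<in> \<D> \<Longrightarrow> \<E> (\<lambda>x. t * f x) (\<lambda>x. t * f x) = t\<^sup>2 * \<E> f f"
  using energy_add_mult_self[OF zero_in_D, of f t] by (simp add: energy_zero)

text \<open>Semicontinuity depends on the tail only: beyond some index the error is below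
  \<open>\<epsilon>\<close>, and the earlier terms are dropped. This makes the limit of a minimizing
  sequence a minimizer.\<close>

lemma energy_limit_le:
  assumes F: "\<And>n. F n \<in> \<D>" and M: "\<And>n. \<E> (F n) (F n) \<le> M + \<delta> n"
    and \<delta>: "\<delta> \<longlonglongrightarrow> 0" and lim: "\<And>x. (\<lambda>n. F n x) \<longlonglongrightarrow> g x"
  shows "\<E> g g \<le> M"
proof (rule field_le_epsilon)
  fix \<epsilon> :: real
  assume "0 < \<epsilon>"
  then obtain N where N: "\<And>n. n \<ge> N \<Longrightarrow> \<delta> n < \<epsilon>"
    using order_tendstoD(2)[OF \<delta>] by (auto simp: eventually_sequentially)
  show "\<E> g g \<le> M + \<epsilon>"
  proof (rule limit_in_D(2))
    show "F (n + N) \<in> \<D>" for n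
      by (rule F)
    show "\<E> (F (n + N)) (F (n + N)) \<le> M + \<epsilon>" for n
      using M[of "n + N"] N[of "n + N"] by simp
    show "(\<lambda>n. F (n + N) x) \<longlonglongrightarrow> g x" for x
      by (rule LIMSEQ_ignore_initial_segment) (rule lim)
  qed
qed

subsection \<open>Spectral theory of the form\<close>

definition orth_part :: "('v \<Rightarrow> real) set \<Rightarrow> ('v \<Rightarrow> real) set" where
  "orth_part B = {f \<in> \<D>. \<forall>e\<in>B. \<I> f e = 0}"

lemma orth_part_in_D: "f \<in> orth_part B \<Longrightarrow> f \<in> \<D>"
  by (simp add: orth_part_def)

lemma add_mult_in_orth_part:
  "B \<subseteq> \<D> \<Longrightarrow> f \<in> orth_part B \<Longrightarrow> h \<in> orth_part B \<Longrightarrow> (\<lambda>x. f x + t * h x) \<in> orth_part B"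
  by (auto simp: orth_part_def add_mult_in_D inner_add_mult_left in_l2 subset_iff)

lemma mult_in_orth_part: "f \<in> orth_part B \<Longrightarrow> (\<lambda>x. t * f x) \<in> orth_part B"
  by (auto simp: orth_part_def mult_in_D inner_mult_left)

text \<open>Direct method: compactness provides a limit of a normalized minimizing sequence, the
  norm and the orthogonality relations pass to it by \<open>inner_tendsto\<close>, and the energy
  does not jump up by semicontinuity.\<close>

lemma rayleigh_minimizer:
  assumes B: "B \<subseteq> \<D>" and v: "v \<in> orth_part B" "v \<noteq> (\<lambda>x. 0)"
  shows "\<exists>f\<in>orth_part B. \<I> f f = 1 \<and> (\<forall>h\<in>orth_part B. \<E> f f * \<I> h h \<le> \<E> h h)"
proof -
  define S where "S = (\<lambda>h. \<E> h h) ` {h \<in> orth_part B. \<I> h h = 1}"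
  define d where "d = Inf S"
  have normalized: "\<E> h h / \<I> h h \<in> S" if "h \<in> orth_part B" "h \<noteq> (\<lambda>x. 0)" for h
  proof -
    have pos: "0 < \<I> h h"
      using that by (intro inner_pos in_l2 orth_part_in_D)
    define h' where "h' = (\<lambda>x. 1 / sqrt (\<I> h h) * h x)"
    have "h' \<in> orth_part B"
      unfolding h'_def using that by (intro mult_in_orth_part)
    moreover have "\<I> h' h' = 1"
      unfolding h'_def inner_mult_self using pos by (simp add: power_divide)
    moreover have "\<E> h' h' = \<E> h h / \<I> h h"
      unfolding h'_def energy_mult_self[OF orth_part_in_D[OF that(1)]]
      using pos by (simp add: power_divide)
    ultimately show ?thesis
      by (force simp: S_def)
  qed
  have bdd: "bdd_below S"
    by (auto simp: S_def energy_nonneg intro!: bdd_belowI[of _ 0])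
  have "S \<noteq> {}"
    using normalized[OF v] by auto
  then have "\<exists>h. h \<in> orth_part B \<and> \<I> h h = 1 \<and> \<E> h h \<le> d + 1 / real (Suc n)" for n
    using cInf_lessD[of S "d + 1 / real (Suc n)"] by (force simp: S_def d_def)
  then obtain F where F: "\<And>n. F n \<in> orth_part B" "\<And>n. \<I> (F n) (F n) = 1"
    "\<And>n. \<E> (F n) (F n) \<le> d + 1 / real (Suc n)"
    by metis
  have FD: "F n \<in> \<D>" for n
    by (rule orth_part_in_D[OF F(1)])
  have FM: "\<E> (F n) (F n) \<le> d + 1" for n
  proof -
    have "1 / real (Suc n) \<le> 1"
      by simp
    with F(3)[of n] show ?thesis
      by linarith
  qed
  obtain r g where r: "strict_mono r" and lim: "\<And>x. (\<lambda>n. F (r n) x) \<longlonglongrightarrow> g x"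
    using compactness[where F = F, OF FD FM] by blast
  have gD: "g \<in> \<D>"
    by (rule limit_in_D(1)[OF FD FM lim])
  have g_le: "\<E> g g \<le> d"
    by (rule energy_limit_le[OF FD F(3) _ lim])
      (use LIMSEQ_subseq_LIMSEQ[OF LIMSEQ_inverse_Suc r] in \<open>simp add: o_def\<close>)
  have "(\<lambda>n. \<I> (F (r n)) (F (r n))) \<longlonglongrightarrow> \<I> g g"
    by (rule inner_tendsto[OF FD FM lim FD FM lim])
  then have g1: "\<I> g g = 1"
    using F(2) by (simp add: LIMSEQ_const_iff)
  have "\<I> g e = 0" if e: "e \<in> B" for e
  proof -
    have "(\<lambda>n. \<I> (F (r n)) e) \<longlonglongrightarrow> \<I> g e"
      \<comment> \<open>The second sequence is constantly \<open>e\<close>, so the common energy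
        bound has to cover \<open>e\<close> as well.\<close>
      by (rule inner_tendsto[where M = "max (d + 1) (\<E> e e)"])
        (use FD FM lim e B in \<open>auto simp: le_max_iff_disj\<close>)
    then show ?thesis
      using F(1) e by (simp add: orth_part_def LIMSEQ_const_iff)
  qed
  then have gB: "g \<in> orth_part B"
    using gD by (simp add: orth_part_def)
  have "\<E> g g * \<I> h h \<le> \<E> h h" if h: "h \<in> orth_part B" for h
  proof (cases "h = (\<lambda>x. 0)")
    case True
    then show ?thesis
      by (simp add: inner_zero energy_zero)
  next
    case False
    have "\<E> g g \<le> \<E> h h / \<I> h h"
      using g_le cInf_lower[OF normalized[OF h False] bdd] by (simp add: d_def)
    moreover have "0 < \<I> h h"
      using h False by (intro inner_pos in_l2 orth_part_in_D)
    ultimately show ?thesis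
      by (simp add: field_simps)
  qed
  with gB g1 show ?thesis
    by blast
qed

text \<open>Euler-Lagrange equation: the Rayleigh inequality along the line through \<open>f\<close>
  in direction \<open>h\<close> is an equality at \<open>t = 0\<close>, so its first-order term
  vanishes.\<close>

lemma rayleigh_minimizer_eq:
  assumes B: "B \<subseteq> \<D>" and f: "f \<in> orth_part B" "\<I> f f = 1"
    and min: "\<And>h. h \<in> orth_part B \<Longrightarrow> \<E> f f * \<I> h h \<le> \<E> h h"
    and h: "h \<in> orth_part B"
  shows "\<E> f h = \<E> f f * \<I> f h"
proof -
  note D = orth_part_in_D[OF f(1)] orth_part_in_D[OF h]
  have "\<E> f f * \<I> f h - \<E> f h = 0"
  proof (rule linear_le_quadratic_imp_zero)
    fix t
    have "\<E> f f * (\<I> f f + 2 * t * \<I> f h + t\<^sup>2 * \<I> h h)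
        \<le> \<E> f f + 2 * t * \<E> f h + t\<^sup>2 * \<E> h h"
      using min[OF add_mult_in_orth_part[OF B f(1) h, of t]] D
      by (simp add: inner_add_mult_self in_l2 energy_add_mult_self)
    then show "2 * t * (\<E> f f * \<I> f h - \<E> f h) \<le> t\<^sup>2 * (\<E> h h - \<E> f f * \<I> h h)"
      using f(2) by (simp add: algebra_simps)
  qed
  then show ?thesis
    by simp
qed

section \<open>Closures in the weighted l2 space\<close>

lemma l2_closure_iff:
  "f \<in> l2_closure \<Omega> (pmf m) S \<longleftrightarrow> f \<in> l2 \<Omega> (pmf m) \<and>
    (\<exists>F. (\<forall>n. F n \<in> S) \<and> (\<lambda>n. \<I> (\<lambda>x. F n x - f x) (\<lambda>x. F n x - f x)) \<longlonglongrightarrow> 0)"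
proof -
  have "(\<lambda>n. sqrt (a n)) \<longlonglongrightarrow> 0 \<longleftrightarrow> a \<longlonglongrightarrow> 0" if "\<And>n. 0 \<le> a n" for a :: "nat \<Rightarrow> real"
  proof
    assume "(\<lambda>n. sqrt (a n)) \<longlonglongrightarrow> 0"
    from tendsto_power[OF this, of 2] show "a \<longlonglongrightarrow> 0"
      using that by simp
  next
    assume "a \<longlonglongrightarrow> 0"
    from tendsto_real_sqrt[OF this] show "(\<lambda>n. sqrt (a n)) \<longlonglongrightarrow> 0"
      by simp
  qed
  then show ?thesis
    by (simp add: l2_closure_def l2_norm_def inner_nonneg)
qed

lemma subset_l2_closure:
  assumes S: "S \<subseteq> l2 \<Omega> (pmf m)"
  shows "S \<subseteq> l2_closure \<Omega> (pmf m) S"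
proof
  fix f assume f: "f \<in> S"
  then have "\<exists>F. (\<forall>n. F n \<in> S) \<and> (\<lambda>n. \<I> (\<lambda>x. F n x - f x) (\<lambda>x. F n x - f x)) \<longlonglongrightarrow> 0"
    by (intro exI[of _ "\<lambda>n. f"]) (simp add: inner_zero)
  with f S show "f \<in> l2_closure \<Omega> (pmf m) S"
    by (auto simp: l2_closure_iff)
qed

text \<open>Closing twice adds nothing: for each \<open>n\<close>, some element of \<open>S\<close>
  lies within squared distance \<open>1 / real (Suc n)\<close> of \<open>F n\<close>. As distances
  stay squared, \<open>weighted_inner_add_le\<close> replaces the triangle inequality.\<close>

lemma l2_closure_minimal:
  assumes S: "S \<subseteq> l2 \<Omega> (pmf m)" and T: "T \<subseteq> l2_closure \<Omega> (pmf m) S"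
  shows "l2_closure \<Omega> (pmf m) T \<subseteq> l2_closure \<Omega> (pmf m) S"
proof
  let ?dist = "\<lambda>f g. \<I> (\<lambda>x. f x - g x) (\<lambda>x. f x - g x)"
  fix f assume "f \<in> l2_closure \<Omega> (pmf m) T"
  then obtain F where f: "f \<in> l2 \<Omega> (pmf m)" and F: "\<And>n. F n \<in> T"
    and F_lim: "(\<lambda>n. ?dist (F n) f) \<longlonglongrightarrow> 0"
    by (auto simp: l2_closure_iff)
  have "\<exists>s\<in>S. ?dist s (F n) \<le> 1 / real (Suc n)" for n
  proof -
    obtain G where G: "\<And>k. G k \<in> S" "(\<lambda>k. ?dist (G k) (F n)) \<longlonglongrightarrow> 0"
      using F[of n] T by (auto simp: l2_closure_iff subset_iff)
    have "\<forall>\<^sub>F k in sequentially. ?dist (G k) (F n) < 1 / real (Suc n)"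
      by (rule order_tendstoD(2)[OF G(2)]) simp
    then obtain k where "?dist (G k) (F n) < 1 / real (Suc n)"
      by (auto simp: eventually_sequentially)
    with G(1) show ?thesis
      by (meson less_imp_le)
  qed
  then obtain s where s: "\<And>n. s n \<in> S" "\<And>n. ?dist (s n) (F n) \<le> 1 / real (Suc n)"
    by metis
  have diff: "sq_summable \<Omega> (pmf m) (\<lambda>x. u x - v x)"
    if "u \<in> l2 \<Omega> (pmf m)" "v \<in> l2 \<Omega> (pmf m)" for u v
    using add_mult_in_l2[OF that, of "-1"] by (simp add: l2_iff)
  have FL: "F n \<in> l2 \<Omega> (pmf m)" "s n \<in> l2 \<Omega> (pmf m)" for n
    using F[of n] s(1)[of n] S T by (auto simp: l2_closure_iff subset_iff)
  have "(\<lambda>n. ?dist (s n) f) \<longlonglongrightarrow> 0"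
  proof (rule tendsto_sandwich)
    show "\<forall>\<^sub>F n in sequentially. 0 \<le> ?dist (s n) f"
      by (simp add: inner_nonneg)
    show "\<forall>\<^sub>F n in sequentially. ?dist (s n) f \<le> 2 * (1 / real (Suc n)) + 2 * ?dist (F n) f"
    proof (rule always_eventually, rule allI)
      fix n
      have "?dist (s n) f \<le> 2 * ?dist (s n) (F n) + 2 * ?dist (F n) f"
        using weighted_inner_add_le[where W = "pmf m" and A = \<Omega>, OF _ diff[OF FL(2)[of n] FL(1)[of n]]
            diff[OF FL(1)[of n] f]]
        by (simp add: l2_inner_eq)
      with s(2)[of n] show "?dist (s n) f \<le> 2 * (1 / real (Suc n)) + 2 * ?dist (F n) f"
        by linarith
    qed
    show "(\<lambda>n. 2 * (1 / real (Suc n)) + 2 * ?dist (F n) f) \<longlonglongrightarrow> 0"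
      using tendsto_add[OF tendsto_mult[OF tendsto_const LIMSEQ_inverse_Suc]
          tendsto_mult[OF tendsto_const F_lim], of 2 2] by simp
  qed simp
  with f s(1) show "f \<in> l2_closure \<Omega> (pmf m) S"
    by (auto simp: l2_closure_iff)
qed

text \<open>The operator also demands that the multiple of \<open>f\<close> by \<open>l\<close> lies
  in the form space; this is automatic, since the form domain is contained in its closure.\<close>

lemma eigenvector_iff:
  "eigenvector b \<Omega> (pmf m) l f \<longleftrightarrow>
    f \<in> \<D> \<and> f \<noteq> (\<lambda>x. 0) \<and> (\<forall>h\<in>\<D>. \<E> f h = l * \<I> f h)"
proof -
  have "(\<lambda>x. l * f x) \<in> form_space b \<Omega> (pmf m)" if "f \<in> \<D>"
    using subset_l2_closure[OF D_subset_l2] mult_in_D[OF that]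
    by (auto simp: form_space_def form_dom_eq)
  then show ?thesis
    by (auto simp: eigenvector_def form_operator_def form_dom_eq inner_mult_left)
qed

lemma eigenvalue_pos:
  assumes "eigenvector b \<Omega> (pmf m) l f"
  shows "0 < l"
proof -
  have "f \<in> \<D>" "f \<noteq> (\<lambda>x. 0)" "\<E> f f = l * \<I> f f"
    using assms by (auto simp: eigenvector_iff)
  then have "0 < l * \<I> f f"
    using energy_pos by metis
  then show ?thesis
    using inner_nonneg[of f] by (simp add: zero_less_mult_iff)
qed

text \<open>
  Semicontinuity applied to \<open>F n + t h\<close> bounds a function that is affine in \<open>t\<close> with slope
  \<open>2 \<E>(g, h)\<close>, so weak convergence in energy is not needed.
\<close>

lemma energy_orth_limit:
  assumes F: "\<And>n. F n \<in> \<D>" and M: "\<And>n. \<E> (F n) (F n) \<le> M"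
    and lim: "\<And>x. (\<lambda>n. F n x) \<longlonglongrightarrow> g x"
    and h: "h \<in> \<D>" and orth: "\<And>n. \<E> (F n) h = 0"
  shows "\<E> g h = 0"
proof (cases "h = (\<lambda>x. 0)")
  case True
  then show ?thesis
    by (simp add: energy_zero energy_commute[of g])
next
  case False
  have g: "g \<in> \<D>"
    by (rule limit_in_D(1)[OF F M lim])
  have bound: "\<E> g g + 2 * t * \<E> g h \<le> M" for t
  proof -
    have "\<E> (\<lambda>x. g x + t * h x) (\<lambda>x. g x + t * h x) \<le> M + t\<^sup>2 * \<E> h h"
    proof (rule limit_in_D(2))
      show "(\<lambda>x. F n x + t * h x) \<in> \<D>" for n
        by (intro add_mult_in_D F h)
      show "\<E> (\<lambda>x. F n x + t * h x) (\<lambda>x. F n x + t * h x) \<le> M + t\<^sup>2 * \<E> h h" for n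
        using M[of n] by (simp add: energy_add_mult_self F h orth)
      show "(\<lambda>n. F n x + t * h x) \<longlonglongrightarrow> g x + t * h x" for x
        by (intro tendsto_intros lim)
    qed
    then show ?thesis
      by (simp add: energy_add_mult_self g h)
  qed
  show ?thesis
  proof (rule ccontr)
    assume "\<E> g h \<noteq> 0"
    \<comment> \<open>This value of \<open>t\<close> turns the bound into
      \<open>\<E> g g + (M + 1) \<le> M\<close>, which contradicts nonnegativity of the
      energy.\<close>
    then have "2 * ((M + 1) / (2 * \<E> g h)) * \<E> g h = M + 1"
      by simp
    with bound[of "(M + 1) / (2 * \<E> g h)"] energy_nonneg[of g] show False
      by linarith
  qed
qed

text \<open>
  The limit of an energy-minimizing sequence in the span. Its residual is orthogonal to \<open>B\<close> in
  \<open>\<ell>\<^sup>2\<close> because for an eigenvector \<open>e\<close> the quantity \<open>\<E>(u, e)\<close> is a multiple of \<open>\<langle>u, e\<rangle>\<close>, which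
  does pass to pointwise limits.
\<close>

lemma projection_lin_span:
  assumes eig: "\<And>e. e \<in> B \<Longrightarrow> \<exists>l. eigenvector b \<Omega> (pmf m) l e" and h: "h \<in> \<D>"
  shows "\<exists>s g M. (\<forall>n. s n \<in> lin_span B \<and> \<E> (s n) (s n) \<le> M) \<and>
    (\<forall>x. (\<lambda>n. s n x) \<longlonglongrightarrow> g x) \<and> (\<lambda>x. h x - g x) \<in> orth_part B"
proof -
  have BD: "B \<subseteq> \<D>"
    using eig by (auto simp: eigenvector_iff)
  have span_D: "s \<in> \<D>" if "s \<in> lin_span B" for s
    using that by (induction rule: lin_span_induct) (use BD in \<open>auto intro: zero_in_D add_mult_in_D\<close>)
  let ?rest = "\<lambda>s x. h x + (- 1) * s x"
  define S where "S = (\<lambda>s. \<E> (?rest s) (?rest s)) ` lin_span B"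
  define d where "d = Inf S"
  have bdd: "bdd_below S"
    by (auto simp: S_def energy_nonneg intro!: bdd_belowI[of _ 0])
  have "S \<noteq> {}"
    using zero_in_lin_span by (auto simp: S_def)
  then have "\<exists>s. s \<in> lin_span B \<and> \<E> (?rest s) (?rest s) \<le> d + 1 / real (Suc n)" for n
    using cInf_lessD[of S "d + 1 / real (Suc n)"] by (force simp: S_def d_def)
  then obtain s where s: "\<And>n. s n \<in> lin_span B"
    and s_le: "\<And>n. \<E> (?rest (s n)) (?rest (s n)) \<le> d + 1 / real (Suc n)"
    by metis
  define u where "u = (\<lambda>n. ?rest (s n))"
  have uD: "u n \<in> \<D>" for n
    unfolding u_def by (intro add_mult_in_D h span_D s)
  have u_le: "\<E> (u n) (u n) \<le> d + 1 / real (Suc n)" for n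
    using s_le by (simp add: u_def)
  have uM: "\<E> (u n) (u n) \<le> d + 1" for n
  proof -
    have "1 / real (Suc n) \<le> 1"
      by simp
    with u_le[of n] show ?thesis
      by linarith
  qed
  obtain r v where r: "strict_mono r" and lim: "\<And>x. (\<lambda>n. u (r n) x) \<longlonglongrightarrow> v x"
    using compactness[where F = u, OF uD uM] by blast
  have vD: "v \<in> \<D>"
    by (rule limit_in_D(1)[OF uD uM lim])
  have "\<I> v e = 0" if e: "e \<in> B" for e
  proof -
    obtain l where l: "eigenvector b \<Omega> (pmf m) l e"
      using eig[OF e] by blast
    then have eD: "e \<in> \<D>" and le: "\<And>f. f \<in> \<D> \<Longrightarrow> \<E> f e = l * \<I> f e"
      by (auto simp: eigenvector_iff energy_commute[of _ e] inner_commute[of _ e])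
    have "(\<lambda>n. \<I> (u (r n)) e) \<longlonglongrightarrow> \<I> v e"
      by (rule inner_tendsto[where M = "max (d + 1) (\<E> e e)"])
        (use uD uM lim eD in \<open>auto simp: le_max_iff_disj\<close>)
    then have p_lim: "(\<lambda>n. l * \<I> (u (r n)) e) \<longlonglongrightarrow> l * \<I> v e"
      by (intro tendsto_intros)
    have "l * \<I> v e = 0"
    proof (rule linear_le_quadratic_imp_zero)
      fix t
      \<comment> \<open>Adding a multiple of \<open>e\<close> to \<open>s n\<close> cannot push the
        energy of the residual below \<open>d\<close>, while \<open>u n\<close> is within
        \<open>1 / real (Suc n)\<close> of \<open>d\<close>. In the limit the error disappears and a
        first-order condition remains.\<close>
      have "2 * t * (l * \<I> (u n) e) \<le> 1 / real (Suc n) + t\<^sup>2 * \<E> e e" for n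
      proof -
        have "?rest (\<lambda>x. s n x + t * e x) = (\<lambda>x. u n x + (- t) * e x)"
          by (simp add: u_def algebra_simps)
        then have "\<E> (\<lambda>x. u n x + (- t) * e x) (\<lambda>x. u n x + (- t) * e x) \<in> S"
          unfolding S_def
          by (intro image_eqI[OF _ add_mult_in_lin_span[OF s e, of n t]]) simp
        then have "d \<le> \<E> (\<lambda>x. u n x + (- t) * e x) (\<lambda>x. u n x + (- t) * e x)"
          unfolding d_def using bdd by (rule cInf_lower)
        also have "\<dots> = \<E> (u n) (u n) - 2 * t * (l * \<I> (u n) e) + t\<^sup>2 * \<E> e e"
          using energy_add_mult_self[OF uD eD, of n "- t"] le[OF uD] by simp
        finally show ?thesis
          using u_le[of n] by linarith
      qed
      then have "2 * t * (l * \<I> v e) \<le> 0 + t\<^sup>2 * \<E> e e"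
        using LIMSEQ_subseq_LIMSEQ[OF LIMSEQ_inverse_Suc r]
        by (intro LIMSEQ_le[OF tendsto_mult[OF tendsto_const p_lim]
              tendsto_add[OF _ tendsto_const]]) (auto simp: o_def)
      then show "2 * t * (l * \<I> v e) \<le> t\<^sup>2 * \<E> e e"
        by simp
    qed
    with eigenvalue_pos[OF l] show ?thesis
      by simp
  qed
  then have v_orth: "v \<in> orth_part B"
    using vD by (simp add: orth_part_def)
  have s_eq: "s n = (\<lambda>x. h x + (- 1) * u n x)" for n
    by (simp add: u_def)
  \<comment> \<open>Parallelogram bound: nonnegativity of the energy of the sum of \<open>h\<close>
    and \<open>u n\<close> controls the cross term in the energy of their difference.\<close>
  have "\<E> (s n) (s n) \<le> 2 * \<E> h h + 2 * (d + 1)" for n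
    using energy_nonneg[of "\<lambda>x. h x + 1 * u n x"] uM[of n] uD[of n] h
    unfolding s_eq energy_add_mult_self[OF h uD] by simp
  moreover have "(\<lambda>n. s (r n) x) \<longlonglongrightarrow> h x - v x" for x
    using tendsto_diff[OF tendsto_const lim] by (simp add: s_eq)
  ultimately show ?thesis
    using v_orth s
    by (intro exI[of _ "\<lambda>n. s (r n)"] exI[of _ "\<lambda>x. h x - v x"]
        exI[of _ "2 * \<E> h h + 2 * (d + 1)"]) simp
qed

section \<open>Maximal orthonormal systems of eigenvectors\<close>

definition orthonormal_eigenvectors :: "('v \<Rightarrow> real) set set" where
  "orthonormal_eigenvectors = {B. (\<forall>e\<in>B. \<exists>l. eigenvector b \<Omega> (pmf m) l e) \<and>
     (\<forall>e\<in>B. \<forall>e'\<in>B. \<I> e e' = (if e = e' then 1 else 0))}"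

text \<open>A nonzero \<open>v\<close> would guarantee a Rayleigh minimizer on the orthogonal part.
  That minimizer is an eigenvector orthogonal to \<open>B\<close>, and adjoining it would contradict
  maximality.\<close>

lemma maximal_orth_part:
  assumes B: "B \<in> orthonormal_eigenvectors"
    and max: "\<And>B'. B' \<in> orthonormal_eigenvectors \<Longrightarrow> B \<subseteq> B' \<Longrightarrow> B' = B"
    and v: "v \<in> orth_part B"
  shows "v = (\<lambda>x. 0)"
proof (rule ccontr)
  assume "v \<noteq> (\<lambda>x. 0)"
  have eig: "\<And>e. e \<in> B \<Longrightarrow> \<exists>l. eigenvector b \<Omega> (pmf m) l e"
    using B by (auto simp: orthonormal_eigenvectors_def)
  have BD: "B \<subseteq> \<D>"
    using eig by (auto simp: eigenvector_iff)
  obtain f where f: "f \<in> orth_part B" "\<I> f f = 1"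
    and min: "\<And>h. h \<in> orth_part B \<Longrightarrow> \<E> f f * \<I> h h \<le> \<E> h h"
    using rayleigh_minimizer[OF BD v \<open>v \<noteq> _\<close>] by blast
  have fD: "f \<in> \<D>"
    by (rule orth_part_in_D[OF f(1)])
  \<comment> \<open>Minimality gives the eigenvalue equation only against
    \<open>orth_part B\<close>. A general \<open>h\<close> splits into such a part and a limit
    \<open>g\<close> of elements of the span, on which both sides vanish.\<close>
  have "\<E> f h = \<E> f f * \<I> f h" if h: "h \<in> \<D>" for h
  proof -
    obtain s g M where "\<forall>n. s n \<in> lin_span B \<and> \<E> (s n) (s n) \<le> M"
      and "\<forall>x. (\<lambda>n. s n x) \<longlonglongrightarrow> g x" and w: "(\<lambda>x. h x - g x) \<in> orth_part B"
      using projection_lin_span[OF eig h] by blast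
    then have s: "\<And>n. s n \<in> lin_span B" "\<And>n. \<E> (s n) (s n) \<le> M"
      and lim: "\<And>x. (\<lambda>n. s n x) \<longlonglongrightarrow> g x"
      by auto
    \<comment> \<open>Orthogonality of \<open>f\<close> to \<open>B\<close> in the inner product
      implies orthogonality in energy, because every \<open>e\<close> in \<open>B\<close> is an
      eigenvector.\<close>
    have span: "s \<in> \<D> \<and> \<E> s f = 0 \<and> \<I> s f = 0" if "s \<in> lin_span B" for s
      using that
    proof (induction rule: lin_span_induct)
      case zero
      show ?case
        by (simp add: zero_in_D energy_zero inner_zero)
    next
      case (add s e t)
      obtain l where "eigenvector b \<Omega> (pmf m) l e"
        using eig[OF add.hyps(2)] by blast
      moreover have "\<I> e f = 0"
        using f(1) add.hyps(2) by (simp add: orth_part_def inner_commute[of e f])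
      ultimately have "e \<in> \<D>" "\<E> e f = 0" "\<I> e f = 0"
        using fD by (auto simp: eigenvector_iff)
      with add fD show ?case
        by (simp add: add_mult_in_D energy_add_mult_left inner_add_mult_left in_l2)
    qed
    note sD = span[OF s(1), THEN conjunct1]
    have gD: "g \<in> \<D>"
      by (rule limit_in_D(1)[OF sD s(2) lim])
    have "\<E> g f = 0"
      by (rule energy_orth_limit[OF sD s(2) lim fD]) (use span[OF s(1)] in auto)
    moreover have "(\<lambda>n. \<I> (s n) f) \<longlonglongrightarrow> \<I> g f"
      by (rule inner_tendsto[where M = "max M (\<E> f f)"])
        (use sD s(2) lim fD in \<open>auto simp: le_max_iff_disj\<close>)
    then have "\<I> g f = 0"
      using span[OF s(1)] by (simp add: LIMSEQ_const_iff)
    moreover have "\<E> (\<lambda>x. h x + (- 1) * g x) f = \<E> f f * \<I> (\<lambda>x. h x + (- 1) * g x) f"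
      using rayleigh_minimizer_eq[OF BD f min w] energy_commute[of f "\<lambda>x. h x - g x"]
        inner_commute[of f "\<lambda>x. h x - g x"] by simp
    moreover have "\<E> (\<lambda>x. h x + (- 1) * g x) f = \<E> h f - \<E> g f"
      using energy_add_mult_left[OF h gD fD, of "- 1"] by simp
    moreover have "\<I> (\<lambda>x. h x + (- 1) * g x) f = \<I> h f - \<I> g f"
      using inner_add_mult_left[OF in_l2[OF h] in_l2[OF gD] in_l2[OF fD], of "- 1"] by simp
    ultimately show ?thesis
      using energy_commute[of f h] inner_commute[of f h] by simp
  qed
  moreover have "f \<noteq> (\<lambda>x. 0)"
    using f(2) by (auto simp: inner_zero)
  ultimately have "eigenvector b \<Omega> (pmf m) (\<E> f f) f"
    unfolding eigenvector_iff using fD by blast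
  moreover have "\<I> f e = 0 \<and> \<I> e f = 0 \<and> e \<noteq> f" if "e \<in> B" for e
    using f that inner_commute[of e f] by (auto simp: orth_part_def)
  ultimately have "insert f B \<in> orthonormal_eigenvectors"
    using B f(2) by (auto simp: orthonormal_eigenvectors_def)
  then have "f \<in> B"
    using max[OF _ subset_insertI[of B f]] by auto
  with f show False
    by (auto simp: orth_part_def)
qed

text \<open>Zorn's lemma gives a maximal orthonormal set of eigenvectors. By maximality the
  projection residual of every \<open>h\<close> in the form domain vanishes, so elements of the span
  converge to \<open>h\<close> in l2; taking closures gives the whole form space.\<close>

lemma pure_point: "pure_point_spectrum b \<Omega> (pmf m)"
proof -
  have "\<exists>B\<in>orthonormal_eigenvectors. \<forall>B'\<in>orthonormal_eigenvectors. B \<subseteq> B' \<longrightarrow> B' = B"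
  proof (rule subset_Zorn')
    fix C assume C: "subset.chain orthonormal_eigenvectors C"
    \<comment> \<open>Orthonormality involves two vectors at a time, and any two members of the
      chain are nested, so both vectors lie in one of them.\<close>
    have "\<I> e e' = (if e = e' then 1 else 0)" if "X \<in> C" "Y \<in> C" "e \<in> X" "e' \<in> Y" for e e' X Y
    proof -
      have "X \<subseteq> Y \<or> Y \<subseteq> X" and "X \<in> orthonormal_eigenvectors" "Y \<in> orthonormal_eigenvectors"
        using C that by (auto simp: subset.chain_def)
      with that show ?thesis
        unfolding orthonormal_eigenvectors_def by blast
    qed
    then show "\<Union> C \<in> orthonormal_eigenvectors"
      using C by (fastforce simp: orthonormal_eigenvectors_def subset.chain_def)
  qed
  then obtain B where B: "B \<in> orthonormal_eigenvectors"
    and max: "\<And>B'. B' \<in> orthonormal_eigenvectors \<Longrightarrow> B \<subseteq> B' \<Longrightarrow> B' = B"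
    by blast
  have eig: "\<And>e. e \<in> B \<Longrightarrow> \<exists>l. eigenvector b \<Omega> (pmf m) l e"
    using B by (auto simp: orthonormal_eigenvectors_def)
  have BD: "B \<subseteq> \<D>"
    using eig by (auto simp: eigenvector_iff)
  have span_D: "lin_span B \<subseteq> \<D>"
  proof
    show "s \<in> \<D>" if "s \<in> lin_span B" for s
      using that
      by (induction rule: lin_span_induct) (use BD in \<open>auto intro: zero_in_D add_mult_in_D\<close>)
  qed
  have dense: "\<D> \<subseteq> l2_closure \<Omega> (pmf m) (lin_span B)"
  proof
    fix h assume h: "h \<in> \<D>"
    obtain s g M where "\<forall>n. s n \<in> lin_span B \<and> \<E> (s n) (s n) \<le> M"
      and "\<forall>x. (\<lambda>n. s n x) \<longlonglongrightarrow> g x" and w: "(\<lambda>x. h x - g x) \<in> orth_part B"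
      using projection_lin_span[OF eig h] by blast
    then have s: "\<And>n. s n \<in> lin_span B" "\<And>n. \<E> (s n) (s n) \<le> M"
      and lim: "\<And>x. (\<lambda>n. s n x) \<longlonglongrightarrow> g x"
      by auto
    have gh: "g = h"
      using maximal_orth_part[OF B max w] by (auto simp: fun_eq_iff)
    let ?u = "\<lambda>n x. s n x + (- 1) * h x"
    have sD: "s n \<in> \<D>" for n
      using s(1) span_D by blast
    have uD: "?u n \<in> \<D>" for n
      by (intro add_mult_in_D sD h)
    have uM: "\<E> (?u n) (?u n) \<le> 2 * M + 2 * \<E> h h" for n
      using energy_nonneg[of "\<lambda>x. s n x + 1 * h x"] s(2)[of n]
      unfolding energy_add_mult_self[OF sD h] by simp
    have u_lim: "(\<lambda>n. ?u n x) \<longlonglongrightarrow> 0" for x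
      using tendsto_diff[OF lim[of x] tendsto_const[of "h x"]] by (simp add: gh)
    have "(\<lambda>n. \<I> (?u n) (?u n)) \<longlonglongrightarrow> \<I> (\<lambda>x. 0) (\<lambda>x. 0)"
      by (rule inner_tendsto[OF uD uM u_lim uD uM u_lim])
    with s(1) h show "h \<in> l2_closure \<Omega> (pmf m) (lin_span B)"
      by (auto simp: l2_closure_iff in_l2 inner_zero)
  qed
  have span_l2: "lin_span B \<subseteq> l2 \<Omega> (pmf m)"
    using span_D D_subset_l2 by blast
  have "l2_closure \<Omega> (pmf m) (lin_span B) = form_space b \<Omega> (pmf m)"
    unfolding form_space_def form_dom_eq
  proof (rule antisym)
    show "l2_closure \<Omega> (pmf m) (lin_span B) \<subseteq> l2_closure \<Omega> (pmf m) \<D>"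
      using span_D subset_l2_closure[OF D_subset_l2]
      by (intro l2_closure_minimal D_subset_l2) blast
    show "l2_closure \<Omega> (pmf m) \<D> \<subseteq> l2_closure \<Omega> (pmf m) (lin_span B)"
      by (rule l2_closure_minimal[OF span_l2 dense])
  qed
  moreover have "B \<subseteq> form_space b \<Omega> (pmf m)"
    using BD subset_l2_closure[OF D_subset_l2] by (auto simp: form_space_def form_dom_eq)
  ultimately show ?thesis
    using B unfolding pure_point_spectrum_def orthonormal_basis_def orthonormal_eigenvectors_def
    by blast
qed

text \<open>With \<open>B\<close> empty the minimization runs over the whole form domain. The
  minimum is an eigenvalue, and every eigenvalue is the Rayleigh quotient of its eigenvector, hence
  not smaller.\<close>

lemma lowest_eigenvalue_rayleigh:
  assumes "\<D> \<noteq> {\<lambda>x. 0}"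
  shows "\<exists>l. lowest_eigenvalue b \<Omega> (pmf m) (ereal l) \<and> (\<forall>h\<in>\<D>. l * \<I> h h \<le> \<E> h h)"
proof -
  have all: "orth_part {} = \<D>"
    by (simp add: orth_part_def)
  obtain v where "v \<in> orth_part {}" "v \<noteq> (\<lambda>x. 0)"
    using assms zero_in_D by (auto simp: all)
  then obtain f where f: "f \<in> orth_part {}" "\<I> f f = 1"
    and min: "\<And>h. h \<in> orth_part {} \<Longrightarrow> \<E> f f * \<I> h h \<le> \<E> h h"
    using rayleigh_minimizer[OF empty_subsetI] by blast
  have "f \<noteq> (\<lambda>x. 0)"
    using f(2) by (auto simp: inner_zero)
  then have "eigenvector b \<Omega> (pmf m) (\<E> f f) f"
    unfolding eigenvector_iff
    using rayleigh_minimizer_eq[OF empty_subsetI f min] f(1) unfolding all by blast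
  moreover have "\<E> f f \<le> l'" if l': "eigenvector b \<Omega> (pmf m) l' h" for l' h
  proof -
    have h: "h \<in> \<D>" "h \<noteq> (\<lambda>x. 0)" "\<E> h h = l' * \<I> h h"
      using l' by (auto simp: eigenvector_iff)
    then have "\<E> f f * \<I> h h \<le> l' * \<I> h h"
      using min[of h] by (simp add: all)
    moreover have "0 < \<I> h h"
      using h by (intro inner_pos in_l2)
    ultimately show ?thesis
      by simp
  qed
  ultimately have "lowest_eigenvalue b \<Omega> (pmf m) (ereal (\<E> f f))"
    using assms by (auto simp: lowest_eigenvalue_def form_dom_eq eigenvalue_def)
  with min show ?thesis
    unfolding all by blast
qed

end

subsection \<open>The best Poincare constant\<close>

text \<open>A point mass at \<open>x\<close> of weight \<open>1 - \<epsilon>\<close> is mixed with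
  the image of a geometric law under an enumeration of \<open>\<Omega>\<close>, which charges every
  point whether \<open>\<Omega>\<close> is finite or infinite.\<close>

lemma concentrated_pmf:
  fixes \<Omega> :: "'v::countable set"
  assumes x: "x \<in> \<Omega>" and \<epsilon>: "0 < \<epsilon>" "\<epsilon> < 1"
  shows "\<exists>m. set_pmf m = \<Omega> \<and> 1 - \<epsilon> \<le> pmf m x"
proof -
  define m0 where "m0 = map_pmf (from_nat_into \<Omega>) (geometric_pmf (1/2))"
  define m where "m = bind_pmf (bernoulli_pmf (1 - \<epsilon>)) (\<lambda>c. if c then return_pmf x else m0)"
  have "range (from_nat_into \<Omega>) = \<Omega>"
    using x by (intro range_from_nat_into) auto
  then have "set_pmf m0 = \<Omega>"
    by (simp add: m0_def set_pmf_geometric)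
  then have "set_pmf m = \<Omega>"
    using x \<epsilon> by (auto simp: m_def set_pmf_bernoulli split: if_splits)
  moreover have "pmf m x = (1 - \<epsilon>) + \<epsilon> * pmf m0 x"
    using \<epsilon> by (simp add: m_def pmf_bind)
  ultimately show ?thesis
    using \<epsilon> by (intro exI[of _ m]) simp
qed

lemma best_poincare_const_le:
  "0 \<le> c \<Longrightarrow> poincare_const b \<Omega> c \<Longrightarrow> best_poincare_const b \<Omega> \<le> c"
  unfolding best_poincare_const_def by (rule cInf_lower) (auto intro: bdd_belowI[of _ 0])

text \<open>The infimum is attained: for positive energy, each choice of \<open>f\<close> and
  \<open>x\<close> only demands that \<open>c\<close> is at least a fixed quotient, and this
  survives the infimum.\<close>

lemma poincare_best_poincare_const:
  assumes graph: "weighted_graph b" and "global_poincare b \<Omega>"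
  shows "0 \<le> best_poincare_const b \<Omega>" and "poincare_const b \<Omega> (best_poincare_const b \<Omega>)"
proof -
  let ?S = "{c. 0 \<le> c \<and> poincare_const b \<Omega> c}"
  obtain c where "0 < c" "poincare_const b \<Omega> c"
    using assms(2) by (auto simp: global_poincare_def)
  then have ne: "?S \<noteq> {}"
    by (auto intro!: exI[of _ c])
  then show "0 \<le> best_poincare_const b \<Omega>"
    unfolding best_poincare_const_def by (intro cInf_greatest) auto
  show "poincare_const b \<Omega> (best_poincare_const b \<Omega>)"
    unfolding poincare_const_iff
  proof (intro ballI allI)
    fix f x assume f: "f \<in> energy_functions b \<Omega>"
    have le: "(f x)\<^sup>2 \<le> c * energy b f f" if "c \<in> ?S" for c
      using that f by (auto simp: poincare_const_iff)
    have nn: "0 \<le> energy b f f"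
      by (rule energy_self_nonneg[OF graph])
    show "(f x)\<^sup>2 \<le> best_poincare_const b \<Omega> * energy b f f"
    \<comment> \<open>With zero energy no quotient can be formed, but any admissible constant
      already forces \<open>f x = 0\<close>.\<close>
    proof (cases "energy b f f = 0")
      case True
      then show ?thesis
        using le ne by fastforce
    next
      case False
      then have "(f x)\<^sup>2 / energy b f f \<le> best_poincare_const b \<Omega>"
        unfolding best_poincare_const_def using le nn
        by (intro cInf_greatest ne) (simp add: divide_le_eq)
      then show ?thesis
        using False nn by (simp add: divide_le_eq)
    qed
  qed
qed

text \<open>Every nonnegative constant is admissible here, so the infimum is 0; its reciprocal
  \<open>\<infinity>\<close> agrees with the convention for the lowest eigenvalue.\<close>

lemma best_poincare_const_trivial:
  assumes "energy_functions b \<Omega> = {\<lambda>x. 0}"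
  shows "best_poincare_const b \<Omega> = 0"
proof -
  have "{c. 0 \<le> c \<and> poincare_const b \<Omega> c} = {0..}"
    by (auto simp: poincare_const_iff assms energy_def case_prod_unfold)
  then show ?thesis
    by (simp add: best_poincare_const_def)
qed

lemma best_poincare_const_pos:
  assumes "weighted_graph b" "global_poincare b \<Omega>" and "energy_functions b \<Omega> \<noteq> {\<lambda>x. 0}"
  shows "0 < best_poincare_const b \<Omega>"
proof -
  obtain f where f: "f \<in> energy_functions b \<Omega>" "f \<noteq> (\<lambda>x. 0)"
    using assms(3) zero_in_energy_functions by blast
  then obtain x where "f x \<noteq> 0"
    by auto
  then have "0 < (f x)\<^sup>2"
    by simp
  also have "(f x)\<^sup>2 \<le> best_poincare_const b \<Omega> * energy b f f"
    using poincare_best_poincare_const(2)[OF assms(1,2)] f(1) by (simp add: poincare_const_iff)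
  finally show ?thesis
    using poincare_best_poincare_const(1)[OF assms(1,2)] by (simp add: zero_less_mult_iff)
qed

lemma (in poincare_form) eigenvalue_ge:
  assumes "eigenvalue b \<Omega> (pmf m) l"
  shows "1 / c \<le> l"
proof -
  obtain f where l: "eigenvector b \<Omega> (pmf m) l f"
    using assms by (auto simp: eigenvalue_def)
  then have f: "f \<in> \<D>" "f \<noteq> (\<lambda>x. 0)" and eq: "\<E> f f = l * \<I> f f"
    by (auto simp: eigenvector_iff)
  have "\<I> f f \<le> c * \<E> f f"
    by (rule inner_le_point_bound) (rule point_le_energy[OF f(1)])
  also have "\<dots> = \<I> f f * (c * l)"
    by (simp add: eq)
  finally have "1 \<le> c * l"
    using inner_pos[OF in_l2[OF f(1)] f(2)] by simp
  then show ?thesis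
    using c_pos by (simp add: divide_le_eq mult.commute)
qed

text \<open>Some \<open>f\<close> violates the inequality with constant \<open>\<kappa>\<close> at
  some \<open>x\<close>. If \<open>m\<close> puts enough mass on \<open>x\<close>, then
  \<open>\<I> f f\<close> is still at least \<open>\<kappa> * \<E> f f\<close>, so the Rayleigh
  quotient of \<open>f\<close> is at most \<open>1 / \<kappa>\<close>.\<close>

lemma lowest_eigenvalue_approx:
  assumes graph: "weighted_graph b" and gp: "global_poincare b \<Omega>"
    and \<kappa>: "0 < \<kappa>" "\<kappa> < best_poincare_const b \<Omega>"
  shows "\<exists>m l. set_pmf m = \<Omega> \<and> lowest_eigenvalue b \<Omega> (pmf m) (ereal l) \<and> l \<le> 1 / \<kappa>"
proof -
  have "\<not> poincare_const b \<Omega> \<kappa>"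
    using best_poincare_const_le[of \<kappa> b \<Omega>] \<kappa> by auto
  then obtain f x where f: "f \<in> energy_functions b \<Omega>" and x: "\<kappa> * energy b f f < (f x)\<^sup>2"
    by (auto simp: poincare_const_iff not_le)
  obtain c where c: "0 < c" "poincare_const b \<Omega> c"
    using gp by (auto simp: global_poincare_def)
  have nn: "0 \<le> energy b f f"
    by (rule energy_self_nonneg[OF graph])
  have fx: "0 < (f x)\<^sup>2"
    using x nn \<kappa>(1) by (meson le_less_trans less_imp_le mult_nonneg_nonneg)
  then have "x \<in> \<Omega>" and f0: "f \<noteq> (\<lambda>x. 0)"
    using f by (auto simp: energy_functions_def supp_def)
  \<comment> \<open>Strictness of the violation gives \<open>q < 1\<close>; the maximum with 1/2
    ensures \<open>q > 0\<close>, so that \<open>1 - q\<close> is a valid parameter for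
    \<open>concentrated_pmf\<close>.\<close>
  define q where "q = max (1/2) (\<kappa> * energy b f f / (f x)\<^sup>2)"
  have q: "0 < q" "q < 1" "\<kappa> * energy b f f \<le> q * (f x)\<^sup>2"
    using x fx by (auto simp: q_def less_max_iff_disj max_def field_simps)
  obtain m where m: "set_pmf m = \<Omega>" "q \<le> pmf m x"
    using concentrated_pmf[OF \<open>x \<in> \<Omega>\<close>, of "1 - q"] q by auto
  interpret poincare_form b \<Omega> c m
    using graph c m(1) by unfold_locales
  have E: "0 < \<E> f f"
    using f f0 by (rule energy_pos)
  have "\<D> \<noteq> {\<lambda>x. 0}"
    using f f0 by blast
  then obtain l where l: "lowest_eigenvalue b \<Omega> (pmf m) (ereal l)"
    and min: "\<And>h. h \<in> \<D> \<Longrightarrow> l * \<I> h h \<le> \<E> h h"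
    using lowest_eigenvalue_rayleigh by blast
  have l_pos: "0 \<le> l"
    using l \<open>\<D> \<noteq> _\<close> c_pos eigenvalue_ge[of l]
    by (auto simp: lowest_eigenvalue_def form_dom_eq intro: order.trans[rotated])
  have "\<kappa> * \<E> f f \<le> q * (f x)\<^sup>2"
    by (rule q(3))
  also have "\<dots> \<le> pmf m x * (f x)\<^sup>2"
    using m(2) by (intro mult_right_mono) auto
  also have "\<dots> \<le> \<I> f f"
    unfolding l2_inner_eq using in_l2[OF f] \<open>x \<in> \<Omega>\<close>
    by (intro weighted_inner_point_le) (auto simp: l2_iff)
  finally have "l * (\<kappa> * \<E> f f) \<le> l * \<I> f f"
    using l_pos by (rule mult_left_mono)
  also have "\<dots> \<le> \<E> f f"
    by (rule min[OF f])
  finally have "(l * \<kappa>) * \<E> f f \<le> 1 * \<E> f f"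
    by (simp add: mult.assoc)
  then have "l * \<kappa> \<le> 1"
    using E by (rule mult_right_le_imp_le)
  then have "l \<le> 1 / \<kappa>"
    using \<kappa>(1) by (simp add: le_divide_eq)
  with m(1) l show ?thesis
    by blast
qed

theorem theorem5p1:
  fixes b :: "'v::countable \<Rightarrow> 'v \<Rightarrow> real" and \<Omega> :: "'v set"
  assumes "weighted_graph b" and "connected_graph b"
    and "global_poincare b \<Omega>"
  shows "(\<forall>m :: 'v pmf. set_pmf m = \<Omega> \<longrightarrow>
            pure_point_spectrum b \<Omega> (pmf m) \<and> (\<exists>l0. lowest_eigenvalue b \<Omega> (pmf m) l0))
       \<and> 1 / ereal (best_poincare_const b \<Omega>)
           = Inf {l0. \<exists>m :: 'v pmf. set_pmf m = \<Omega> \<and> lowest_eigenvalue b \<Omega> (pmf m) l0}"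
    (is "_ \<and> 1 / ereal ?c = Inf ?L")
proof
  obtain c where c: "0 < c" "poincare_const b \<Omega> c"
    using assms(3) by (auto simp: global_poincare_def)
  have form: "poincare_form b \<Omega> c' m" if "0 < c'" "poincare_const b \<Omega> c'" "set_pmf m = \<Omega>" for m c'
    using assms(1) that by unfold_locales
  have lowest: "lowest_eigenvalue b \<Omega> (pmf m) l0 \<longleftrightarrow>
      (if energy_functions b \<Omega> = {\<lambda>x. 0} then l0 = \<infinity>
       else \<exists>l. l0 = ereal l \<and> eigenvalue b \<Omega> (pmf m) l \<and>
                 (\<forall>l'. eigenvalue b \<Omega> (pmf m) l' \<longrightarrow> l \<le> l'))"
    if "set_pmf m = \<Omega>" for m l0
    unfolding lowest_eigenvalue_def poincare_form.form_dom_eq[OF form[OF c that]] ..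
  show "\<forall>m :: 'v pmf. set_pmf m = \<Omega> \<longrightarrow>
      pure_point_spectrum b \<Omega> (pmf m) \<and> (\<exists>l0. lowest_eigenvalue b \<Omega> (pmf m) l0)"
  proof (intro allI impI conjI)
    fix m :: "'v pmf" assume m: "set_pmf m = \<Omega>"
    interpret poincare_form b \<Omega> c m
      by (rule form[OF c m])
    show "pure_point_spectrum b \<Omega> (pmf m)"
      by (rule pure_point)
    show "\<exists>l0. lowest_eigenvalue b \<Omega> (pmf m) l0"
    proof (cases "\<D> = {\<lambda>x. 0}")
      case True
      then show ?thesis
        by (simp add: lowest_eigenvalue_def form_dom_eq)
    next
      case False
      then show ?thesis
        using lowest_eigenvalue_rayleigh by blast
    qed
  qed
  show "1 / ereal ?c = Inf ?L"
  proof (cases "energy_functions b \<Omega> = {\<lambda>x. 0}")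
    case True
    \<comment> \<open>If \<open>\<Omega>\<close> is empty, no probability measure has it as support
      and \<open>?L\<close> is empty; the argument covers this case, as the infimum of the empty set
      is \<open>\<infinity>\<close>.\<close>
    have "l0 = \<infinity>" if "l0 \<in> ?L" for l0
      using that True lowest by auto
    then have "\<infinity> \<le> Inf ?L"
      by (intro Inf_greatest) blast
    then have "Inf ?L = \<infinity>"
      by simp
    then show ?thesis
      by (simp add: best_poincare_const_trivial[OF True])
  next
    case False
    have pos: "0 < ?c"
      by (rule best_poincare_const_pos[OF assms(1,3) False])
    have inv: "1 / ereal ?c = ereal (1 / ?c)"
      using pos by (simp add: divide_ereal_def inverse_eq_divide)
    have best: "poincare_const b \<Omega> ?c"
      by (rule poincare_best_poincare_const(2)[OF assms(1,3)])
    show ?thesis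
    proof (rule antisym)
      show "1 / ereal ?c \<le> Inf ?L"
      proof (rule Inf_greatest)
        fix l0 assume "l0 \<in> ?L"
        then obtain m where m: "set_pmf m = \<Omega>" and "lowest_eigenvalue b \<Omega> (pmf m) l0"
          by blast
        then obtain l where l: "l0 = ereal l" "eigenvalue b \<Omega> (pmf m) l"
          using lowest[OF m] False by auto
        show "1 / ereal ?c \<le> l0"
          using poincare_form.eigenvalue_ge[OF form[OF pos best m] l(2)] by (simp add: inv l(1))
      qed
      show "Inf ?L \<le> 1 / ereal ?c"
        unfolding inv
      proof (rule ereal_le_epsilon2)
        fix e :: real assume e: "0 < e"
        \<comment> \<open>This \<open>\<kappa>\<close> lies below the best constant and is chosen so
          that its reciprocal is \<open>1 / ?c + e\<close>.\<close>
        define \<kappa> where "\<kappa> = 1 / (1 / ?c + e)"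
        have "0 < 1 / ?c"
          using pos by simp
        then have "0 < 1 / ?c + e"
          using e by (rule add_pos_pos)
        then have "0 < \<kappa>" "1 / \<kappa> = 1 / ?c + e"
          by (simp_all add: \<kappa>_def)
        moreover have "\<kappa> < 1 / (1 / ?c)"
          unfolding \<kappa>_def using \<open>0 < 1 / ?c\<close> \<open>0 < 1 / ?c + e\<close> e
          by (intro divide_strict_left_mono mult_pos_pos) simp_all
        ultimately obtain m l where m: "set_pmf m = \<Omega>" "lowest_eigenvalue b \<Omega> (pmf m) (ereal l)"
          and l: "l \<le> 1 / ?c + e"
          using lowest_eigenvalue_approx[OF assms(1,3), of \<kappa>] by auto
        from m have "Inf ?L \<le> ereal l"
          by (intro Inf_lower) blast
        also have "\<dots> \<le> ereal (1 / ?c) + ereal e"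
          using l by simp
        finally show "Inf ?L \<le> ereal (1 / ?c) + ereal e" .
      qed
    qed
  qed
qed

end
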